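(* Let $Q:=q^7$. Then $$\frac{(1,0,56)-(5,4,12)}{(7,0,8)+(3,2,19)}=q\frac{E(q^4)E(Q^8)}{E(q^8)E(Q^4)}.$$
   Context: $|q|<1$, $E(q)=(q;q)_\infty=\prod_{k\ge1}(1-q^k)$. For integers $a,b,c$ with $a,c>0$, $b^2-4ac<0$, $(a,b,c)$ denotes $\sum_{n,m=-\infty}^{\infty}q^{an^2+bnm+cm^2}$. *)

theory Defs
  imports "HOL-Analysis.Analysis"
begin

definition euler_E :: "complex \<Rightarrow> complex" where
  "euler_E q = (\<Prod>k. 1 - q ^ Suc k)"

text \<open>
  The theta series \<open>(a, b, c)\<close> of a binary quadratic form, as an unordered sum over
  all pairs of integers.  It is meant for positive definite forms (\<open>a, c > 0\<close> and
  \<open>b\<^sup>2 - 4ac < 0\<close>) and \<open>\<bar>q\<bar> < 1\<close>, where it converges absolutely and no exponent is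
  negative; the term at \<open>(0, 0)\<close> is \<open>1\<close> also for \<open>q = 0\<close>.
\<close>

definition qf_theta :: "int \<Rightarrow> int \<Rightarrow> int \<Rightarrow> complex \<Rightarrow> complex" where
  "qf_theta a b c q =
     (\<Sum>\<^sub>\<infinity>(n, m)\<in>(UNIV :: (int \<times> int) set). q powi (a * n\<^sup>2 + b * n * m + c * m\<^sup>2))"

end

theory Submission
  imports Defs "HOL-Library.Nat_Bijection"
begin

text \<open>
  Write \<open>G\<close>, \<open>H\<close> for the Rogers-Ramanujan functions and \<open>E\<^sub>n = E(q\<^sup>n)\<close>.  An orthogonal sublattice of
  index 5 splits \<open>(5,4,12)\<close> and \<open>(3,2,19)\<close> into products of one-variable theta functions, each of
  which is a polynomial in values of \<open>G\<close> and \<open>H\<close>; numerator and denominator then both factor: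
  with \<open>A(q) = G(q\<^sup>5\<^sup>6) H(q) - q\<^sup>1\<^sup>1 G(q) H(q\<^sup>5\<^sup>6)\<close> and \<open>B(q) = G(q\<^sup>7) G(q\<^sup>8) + q\<^sup>3 H(q\<^sup>7) H(q\<^sup>8)\<close>,
  the numerator is \<open>2q E\<^sub>2 E\<^sub>1\<^sub>1\<^sub>2 A(q) A(q\<^sup>4)\<close> and the denominator is \<open>2 E\<^sub>1\<^sub>4 E\<^sub>1\<^sub>6 B(q) B(q\<^sup>4)\<close>.

  Watson's 2-dissections of \<open>G\<close> and \<open>H\<close> express \<open>A\<close> and \<open>B\<close> through the two identities of Rogers
  for \<open>G(q) G(q\<^sup>1\<^sup>4) + q\<^sup>3 H(q) H(q\<^sup>1\<^sup>4)\<close> and \<open>G(q\<^sup>7) H(q\<^sup>2) - q G(q\<^sup>2) H(q\<^sup>7)\<close>, whose values are reciprocal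
  quotients of Euler products.  Up to Euler products \<open>A\<close> becomes \<open>a + q\<^sup>3 b\<close> and \<open>B\<close> becomes
  \<open>1/b + q\<^sup>3/a\<close> with the same \<open>a\<close>, \<open>b\<close>, so \<open>A/B\<close> is an eta quotient.
\<close>

section \<open>q-Pochhammer symbols and two-sided sums\<close>

definition qpoch :: "complex \<Rightarrow> complex \<Rightarrow> complex" where
  "qpoch a q = (\<Prod>k. 1 - a * q ^ k)"

lemma euler_E_eq_qpoch: "euler_E q = qpoch q q"
  by (simp add: euler_E_def qpoch_def)

lemma summable_qpoch: "norm q < 1 \<Longrightarrow> summable (\<lambda>k. norm (a * q ^ k))" for a q :: complex
  by (auto simp: norm_mult norm_power intro!: summable_mult summable_geometric)

lemma convergent_prod_qpoch: "norm q < 1 \<Longrightarrow> convergent_prod (\<lambda>k. 1 - a * q ^ k)" for a q :: complex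
  by (intro abs_convergent_prod_imp_convergent_prod summable_imp_abs_convergent_prod)
     (use summable_qpoch[of q a] in simp)

lemma qpoch_tendsto: "norm q < 1 \<Longrightarrow> (\<lambda>n. \<Prod>k<n. 1 - a * q ^ k) \<longlonglongrightarrow> qpoch a q"
  using convergent_prod_LIMSEQ[OF convergent_prod_qpoch[of q a]]
  unfolding qpoch_def LIMSEQ_lessThan_iff_atMost by simp

lemma one_minus_mult_power_nonzero:
  fixes a q :: complex
  assumes "norm q < 1" "norm a < 1"
  shows "1 - a * q ^ k \<noteq> 0"
proof
  assume "1 - a * q ^ k = 0"
  hence "norm a * norm q ^ k = 1"
    by (metis eq_iff_diff_eq_0 norm_mult norm_one norm_power)
  moreover have "norm a * norm q ^ k \<le> norm a * 1"
    using assms by (intro mult_left_mono power_le_one) auto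
  ultimately show False using assms by simp
qed

lemma qpoch_nonzero: "norm q < 1 \<Longrightarrow> norm a < 1 \<Longrightarrow> qpoch a q \<noteq> 0"
  unfolding qpoch_def
  by (intro prodinf_nonzero convergent_prod_qpoch one_minus_mult_power_nonzero)

lemma qpoch_mult_minus:
  assumes "norm q < 1"
  shows "qpoch a q * qpoch (-a) q = qpoch (a\<^sup>2) (q\<^sup>2)"
proof -
  have "qpoch a q * qpoch (-a) q = (\<Prod>k. (1 - a * q ^ k) * (1 - (-a) * q ^ k))"
    unfolding qpoch_def by (intro prodinf_mult convergent_prod_qpoch assms)
  also have "\<dots> = qpoch (a\<^sup>2) (q\<^sup>2)"
    unfolding qpoch_def
    by (intro prodinf_cong) (simp add: algebra_simps power2_eq_square power_mult_distrib)
  finally show ?thesis .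
qed

text \<open>Sorting the factors by the residue of the index modulo \<open>m\<close> rearranges the
  finite products with \<open>n * m\<close> factors, and the infinite product is their limit along
  that subsequence.\<close>

lemma qpoch_split:
  assumes q: "norm q < 1" and m: "m > 0"
  shows "qpoch a q = (\<Prod>i<m. qpoch (a * q ^ i) (q ^ m))"
proof -
  have qm: "norm (q ^ m) < 1"
    using q m by (simp add: norm_power power_less_one_iff)
  have "(\<lambda>n. \<Prod>i<m. \<Prod>k<n. 1 - (a * q ^ i) * (q ^ m) ^ k) \<longlonglongrightarrow> (\<Prod>i<m. qpoch (a * q ^ i) (q ^ m))"
    by (intro tendsto_prod qpoch_tendsto qm)
  moreover have "(\<Prod>i<m. \<Prod>k<n. 1 - (a * q ^ i) * (q ^ m) ^ k) = (\<Prod>k<n*m. 1 - a * q ^ k)" for n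
  proof -
    have split: "(\<Prod>k<N+M. 1 - a * q ^ k) = (\<Prod>k<N. 1 - a * q ^ k) * (\<Prod>i<M. 1 - a * q ^ (N+i))" for N M
      by (induction M) (simp_all add: mult.assoc)
    have "(\<Prod>k<n*m. 1 - a * q ^ k) = (\<Prod>k<n. \<Prod>i<m. 1 - a * q ^ (k*m+i))"
    proof (induction n)
      case (Suc n)
      have "(\<Prod>k<Suc n*m. 1 - a * q ^ k) = (\<Prod>k<n*m+m. 1 - a * q ^ k)"
        by (simp add: add.commute)
      also have "\<dots> = (\<Prod>k<n*m. 1 - a * q ^ k) * (\<Prod>i<m. 1 - a * q ^ (n*m+i))"
        by (rule split)
      finally show ?case using Suc.IH by simp
    qed simp
    also have "\<dots> = (\<Prod>i<m. \<Prod>k<n. 1 - a * q ^ (k*m+i))"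
      by (rule prod.swap)
    finally show ?thesis
      by (simp add: power_add mult_ac flip: power_mult)
  qed
  moreover have "(\<lambda>n. \<Prod>k<n*m. 1 - a * q ^ k) \<longlonglongrightarrow> qpoch a q"
    using LIMSEQ_subseq_LIMSEQ[OF qpoch_tendsto[OF q], of "\<lambda>n. n * m"] m
    by (simp add: strict_mono_def o_def)
  ultimately show ?thesis
    using LIMSEQ_unique by simp
qed

section \<open>Unordered double sums and dominated sums over the integers\<close>

text \<open>For complex terms summability is the same as absolute summability, so the products form
  a summable family on the product set and the double sum may be evaluated row by row.\<close>

lemma has_sum_times:
  fixes f g :: "_ \<Rightarrow> complex"
  assumes f: "(f has_sum F) A" and g: "(g has_sum G) B"
  shows "((\<lambda>(x, y). f x * g y) has_sum (F * G)) (A \<times> B)"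
proof (rule has_sum_SigmaI)
  show "((\<lambda>x. f x * G) has_sum F * G) A"
    by (rule has_sum_cmult_left[OF f])
  show "((\<lambda>y. case (x, y) of (x, y) \<Rightarrow> f x * g y) has_sum f x * G) B" for x
    by (simp add: has_sum_cmult_right[OF g])
  have f': "(\<lambda>x. norm (f x)) summable_on A" and g': "(\<lambda>x. norm (g x)) summable_on B"
    using f g summable_on_iff_abs_summable_on_complex has_sum_imp_summable by blast+
  have "(\<lambda>z. norm (case z of (x, y) \<Rightarrow> f x * g y)) summable_on (A \<times> B)"
    unfolding Infinite_Sum.abs_summable_on_Sigma_iff
  proof (intro conjI ballI)
    show "(\<lambda>y. norm (case (x, y) of (x, y) \<Rightarrow> f x * g y)) summable_on B" for x
      using summable_on_cmult_right[OF g', of "norm (f x)"] by (simp add: norm_mult)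
    have "(\<lambda>x. norm (f x) * infsum (\<lambda>y. norm (g y)) B) summable_on A"
      using summable_on_cmult_left[OF f'] by simp
    thus "(\<lambda>x. norm (\<Sum>\<^sub>\<infinity>y\<in>B. norm (case (x, y) of (x, y) \<Rightarrow> f x * g y))) summable_on A"
      by (simp add: norm_mult infsum_cmult_right' abs_mult infsum_nonneg)
  qed
  thus "(\<lambda>(x, y). f x * g y) summable_on (A \<times> B)"
    using summable_on_iff_abs_summable_on_complex by blast
qed

lemma summable_on_power_abs_int:
  fixes r :: real
  assumes "0 \<le> r" "r < 1"
  shows "(\<lambda>n::int. r ^ nat \<bar>n\<bar>) summable_on UNIV"
proof -
  have geo: "(\<lambda>n::nat. r ^ n) summable_on UNIV"
    using assms by (subst summable_on_UNIV_nonneg_real_iff) (auto intro: summable_geometric)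
  have "(\<lambda>n::int. r ^ nat \<bar>n\<bar>) summable_on {0..}"
    using geo by (subst summable_on_reindex_bij_witness[where i = int and j = nat and T = UNIV and h = "\<lambda>n. r ^ n"]) auto
  moreover have "(\<lambda>n::nat. r ^ Suc n) summable_on UNIV"
    using summable_on_cmult_right[OF geo, of r] by simp
  hence "(\<lambda>n::int. r ^ nat \<bar>n\<bar>) summable_on {..<0}"
    by (subst summable_on_reindex_bij_witness[where i = "\<lambda>n. - int (Suc n)" and j = "\<lambda>n. nat (- n - 1)"
          and T = UNIV and h = "\<lambda>n. r ^ Suc n"]) (auto simp: nat_diff_distrib simp flip: power_Suc)
  ultimately have "(\<lambda>n::int. r ^ nat \<bar>n\<bar>) summable_on ({0..} \<union> {..<0})"
    by (rule summable_on_Un_disjoint) auto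
  moreover have "{0..} \<union> {..<0} = (UNIV :: int set)" by auto
  ultimately show ?thesis by simp
qed

lemma summable_on_int_dominated:
  fixes f :: "int \<Rightarrow> complex" and r :: real
  assumes r: "0 \<le> r" "r < 1" and f: "\<And>n. norm (f n) \<le> r ^ nat \<bar>n\<bar>"
  shows "f summable_on A"
proof -
  have "(\<lambda>n. norm (f n)) summable_on UNIV"
  proof (rule Infinite_Sum.abs_summable_on_comparison_test)
    show "(\<lambda>n::int. norm (r ^ nat \<bar>n\<bar>)) summable_on UNIV"
      using summable_on_power_abs_int[OF r] r by simp
    show "norm (f n) \<le> norm (r ^ nat \<bar>n\<bar>)" for n
      using f[of n] r by simp
  qed
  thus ?thesis
    using summable_on_iff_abs_summable_on_complex summable_on_subset_banach by blast
qed

text \<open>Ramanujan's \<open>f(a, b) = \<Sum> a\<^bsup>n(n+1)/2\<^esup> b\<^bsup>n(n-1)/2\<^esup>\<close>; in this form the triple product needs no assumption \<open>a \<noteq> 0\<close> or \<open>b \<noteq> 0\<close>.\<close>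

definition rterm :: "complex \<Rightarrow> complex \<Rightarrow> int \<Rightarrow> complex" where
  "rterm a b n = a ^ nat (n * (n + 1) div 2) * b ^ nat (n * (n - 1) div 2)"

definition ramanujan_f :: "complex \<Rightarrow> complex \<Rightarrow> complex" where
  "ramanujan_f a b = (\<Sum>\<^sub>\<infinity>n. rterm a b n)"

lemma pronic_nonneg: "0 \<le> n * (n + 1)" "0 \<le> n * (n - 1)" for n :: int
  by (simp_all add: zero_le_mult_iff) linarith+

lemma pronic_half_sum: "nat (n * (n + 1) div 2) + nat (n * (n - 1) div 2) = nat (n * n)" for n :: int
proof -
  have "n * (n + 1) div 2 + n * (n - 1) div 2 = (n * (n + 1) + n * (n - 1)) div 2"
    by (rule div_plus_div_distrib_dvd_left [symmetric]) simp
  also have "\<dots> = n * n" by (simp add: algebra_simps)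
  finally show ?thesis
    using pronic_nonneg[of n] by (metis nat_add_distrib pos_imp_zdiv_nonneg_iff zero_less_numeral)
qed

lemma abs_le_square_int: "\<bar>n\<bar> \<le> n * n" for n :: int
proof (cases "n = 0")
  case False
  hence "\<bar>n\<bar> * 1 \<le> \<bar>n\<bar> * \<bar>n\<bar>" by (intro mult_left_mono) auto
  thus ?thesis by simp
qed simp

text \<open>The two triangular exponents add up to \<open>n^2\<close>, which is at least
  \<open>abs n\<close>. The geometric bound serves for summability and as the majorant in the limit
  of the finite triple product.\<close>

lemma norm_rterm_le: 
  assumes "norm a \<le> r" "norm b \<le> r" "r < 1"
  shows "norm (rterm a b n) \<le> r ^ nat \<bar>n\<bar>"
proof -
  have r: "0 \<le> r" using assms(1) norm_ge_zero order_trans by blast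
  have "norm (rterm a b n) \<le> r ^ nat (n * (n + 1) div 2) * r ^ nat (n * (n - 1) div 2)"
    unfolding rterm_def norm_mult norm_power using assms r by (intro mult_mono power_mono) auto
  also have "\<dots> = r ^ nat (n * n)"
    by (simp only: pronic_half_sum flip: power_add)
  also have "\<dots> \<le> r ^ nat \<bar>n\<bar>"
    using abs_le_square_int[of n] assms r by (intro power_decreasing nat_mono) auto
  finally show ?thesis .
qed

lemma summable_on_rterm:
  assumes "norm a < 1" "norm b < 1"
  shows "rterm a b summable_on A"
  using assms by (intro summable_on_int_dominated[of "max (norm a) (norm b)"] norm_rterm_le) (auto simp: le_max_iff_disj)

lemma has_sum_ramanujan_f:
  assumes "norm a < 1" "norm b < 1"
  shows "(rterm a b has_sum ramanujan_f a b) UNIV"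
  unfolding ramanujan_f_def using summable_on_rterm[OF assms] by simp

section \<open>Jacobi's triple product\<close>

definition qfact :: "complex \<Rightarrow> nat \<Rightarrow> complex" where
  "qfact q m = (\<Prod>k<m. 1 - q * q ^ k)"

text \<open>The reciprocal q-factorial is extended by 0 to negative indices, so that q-binomial
  coefficients vanish outside their range and recurrences also hold at its boundary.\<close>

definition inv_qfact :: "complex \<Rightarrow> int \<Rightarrow> complex" where
  "inv_qfact q m = (if m < 0 then 0 else 1 / qfact q (nat m))"

lemma qfact_nonzero: "norm q < 1 \<Longrightarrow> qfact q m \<noteq> 0"
  unfolding qfact_def using one_minus_mult_power_nonzero[of q q] by (simp add: prod_zero_iff)

lemma qfact_Suc: "qfact q (Suc m) = qfact q m * (1 - q ^ Suc m)"
  by (simp add: qfact_def)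

text \<open>At \<open>m = 0\<close> both sides vanish: the left by the default value, the right
  because of the factor \<open>1 - q^0\<close>.\<close>

lemma inv_qfact_pred:
  assumes "norm q < 1" "m \<ge> 0"
  shows "inv_qfact q (m - 1) = (1 - q ^ nat m) * inv_qfact q m"
proof (cases "m = 0")
  case False
  then obtain k where m: "m = int (Suc k)"
    using assms(2) by (metis nonneg_int_cases of_nat_0 not0_implies_Suc)
  have "1 - q ^ Suc k \<noteq> 0"
    using one_minus_mult_power_nonzero[OF assms(1) assms(1), of k] by simp
  moreover have "nat (int (Suc k)) = Suc k" "nat (int (Suc k) - 1) = k" by simp_all
  ultimately show ?thesis
    using qfact_nonzero[OF assms(1), of k] unfolding m inv_qfact_def
    by (simp only: qfact_Suc) (simp add: divide_simps)
qed (simp add: inv_qfact_def)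

lemma rterm_minus: "rterm a b (-n) = rterm b a n"
  by (simp add: rterm_def algebra_simps)

lemma triangular_Suc: "nat ((n + 1) * (n + 2) div 2) = nat (n * (n + 1) div 2) + nat (n + 1)"
  if "n \<ge> -1" for n :: int
proof -
  have "(n + 1) * (n + 2) div 2 = (n * (n + 1) + (n + 1) * 2) div 2"
    by (simp add: algebra_simps)
  also have "\<dots> = n * (n + 1) div 2 + (n + 1)"
    by simp
  finally show ?thesis
    using that pronic_nonneg[of n] by (simp add: nat_add_distrib)
qed

lemma rterm_Suc:
  assumes "j \<ge> 0"
  shows "rterm a b (j + 1) = rterm a b j * a * (a * b) ^ nat j"
proof -
  have 1: "nat ((j + 1) * (j + 2) div 2) = nat (j * (j + 1) div 2) + nat j + 1"
    using triangular_Suc[of j] assms by simp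
  have 2: "nat ((j + 1) * j div 2) = nat (j * (j - 1) div 2) + nat j"
    using triangular_Suc[of "j - 1"] assms by (simp add: algebra_simps)
  show ?thesis
    unfolding rterm_def using 1 2 by (simp add: power_add power_mult_distrib add_ac)
qed

text \<open>With \<open>q = a * b\<close> this is the effect of multiplying by
  \<open>a * q^n\<close>, which occurs in the new factors of the finite triple product. Since the
  exponents are natural numbers, nonpositive \<open>j\<close> is reduced to \<open>rterm_Suc\<close>
  by reflection.\<close>

lemma rterm_shift_left:
  assumes "int n + 1 \<ge> j"
  shows "rterm a b (j - 1) * (a * (a * b) ^ n) = rterm a b j * (a * b) ^ nat (int n + 1 - j)"
proof (cases "j \<ge> 1")
  case True
  have "rterm a b j * (a * b) ^ nat (int n + 1 - j)
          = rterm a b (j - 1) * a * ((a * b) ^ nat (j - 1) * (a * b) ^ nat (int n + 1 - j))"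
    using rterm_Suc[of "j - 1" a b] True by (simp add: mult_ac)
  also have "nat (j - 1) + nat (int n + 1 - j) = n"
    using True assms by linarith
  hence "(a * b) ^ nat (j - 1) * (a * b) ^ nat (int n + 1 - j) = (a * b) ^ n"
    by (simp flip: power_add)
  finally show ?thesis by (simp add: mult_ac)
next
  case False
  have "rterm a b (j - 1) = rterm b a (- j + 1)"
    using rterm_minus[of a b "- j + 1"] by (simp add: algebra_simps)
  also have "\<dots> = rterm a b j * b * (a * b) ^ nat (- j)"
    using rterm_Suc[of "-j" b a] False rterm_minus[of b a j] by (simp add: mult_ac)
  finally have "rterm a b (j - 1) * (a * (a * b) ^ n) = rterm a b j * ((a * b) ^ (1 + nat (- j) + n))"
    by (simp add: power_add mult_ac)
  also have "1 + nat (- j) + n = nat (int n + 1 - j)"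
    using False by linarith
  finally show ?thesis .
qed

lemma rterm_shift_right:
  assumes "int n + 1 \<ge> - j"
  shows "rterm a b (j + 1) * (b * (a * b) ^ n) = rterm a b j * (a * b) ^ nat (int n + 1 + j)"
  using rterm_shift_left[of "-j" n b a] assms rterm_minus[of b a "j + 1"] rterm_minus[of b a j]
  by (simp add: mult.commute[of b a])

text \<open>The Gaussian binomial coefficient with upper entry \<open>2 * n\<close> and lower entry
  \<open>n + j\<close>, indexed by the distance \<open>j\<close> from the centre.\<close>

definition central_qbinomial :: "complex \<Rightarrow> nat \<Rightarrow> int \<Rightarrow> complex" where
  "central_qbinomial q n j = qfact q (2 * n) * inv_qfact q (int n - j) * inv_qfact q (int n + j)"

text \<open>Two q-Pascal steps at once. After extracting common factors the claim is \<open>(1 +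
  w)(1 - X)(1 - Y) + (1 - Y)(X - w) + (1 - X)(Y - w) = (1 - w)(1 - X Y)\<close>, with
  \<open>X Y = w q\<close>.\<close>

lemma central_qbinomial_Suc:
  assumes q: "norm q < 1" and j: "\<bar>j\<bar> \<le> int n + 1"
  shows "central_qbinomial q (Suc n) j = (1 + q ^ (2 * n + 1)) * central_qbinomial q n j
           + q ^ nat (int n + 1 - j) * central_qbinomial q n (j - 1)
           + q ^ nat (int n + 1 + j) * central_qbinomial q n (j + 1)"
proof -
  define p r where "p = int n + 1 - j" and "r = int n + 1 + j"
  have pr: "p \<ge> 0" "r \<ge> 0" using j by (auto simp: p_def r_def)
  define X Y w where "X = q ^ nat p" and "Y = q ^ nat r" and "w = q ^ (2 * n + 1)"
  define I J where "I = inv_qfact q p" and "J = inv_qfact q r"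
  have XY: "X * Y = w * q"
  proof -
    have "nat p + nat r = Suc (2 * n + 1)" using pr by (simp add: p_def r_def)
    thus ?thesis unfolding X_def Y_def w_def by (metis power_add power_Suc mult.commute)
  qed
  \<comment> \<open>Lowering the index twice gives the factors \<open>1 - q^m\<close> and
    \<open>1 - q^(m-1)\<close>; since \<open>s + m - 1 = 2 n + 1\<close>, the second times
    \<open>q^s\<close> is \<open>q^s - w\<close>. For \<open>m = 0\<close> both sides are 0.\<close>
  have two: "q ^ nat s * inv_qfact q (m - 2) = (1 - q ^ nat m) * (q ^ nat s - w) * inv_qfact q m"
    if "m \<ge> 0" "s \<ge> 0" "m + s = 2 * int n + 2" for m s
  proof (cases "m = 0")
    case False
    have i2: "inv_qfact q (m - 2) = (1 - q ^ nat (m - 1)) * ((1 - q ^ nat m) * inv_qfact q m)"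
      using inv_qfact_pred[OF q, of m] inv_qfact_pred[OF q, of "m - 1"] False that by simp
    have "nat s + nat (m - 1) = 2 * n + 1" using that False by linarith
    hence w: "q ^ nat s * q ^ nat (m - 1) = w"
      by (simp add: w_def flip: power_add)
    show ?thesis unfolding i2 w[symmetric] by (simp add: algebra_simps)
  qed (simp add: inv_qfact_def)
  have A: "X * inv_qfact q (r - 2) = (1 - Y) * (X - w) * J"
    unfolding X_def Y_def J_def by (rule two) (use pr in \<open>auto simp: p_def r_def\<close>)
  have B: "Y * inv_qfact q (p - 2) = (1 - X) * (Y - w) * I"
    unfolding X_def Y_def I_def by (rule two) (use pr in \<open>auto simp: p_def r_def\<close>)
  have C: "inv_qfact q (p - 1) = (1 - X) * I" "inv_qfact q (r - 1) = (1 - Y) * J"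
    unfolding X_def Y_def I_def J_def using pr by (simp_all add: inv_qfact_pred[OF q])
  have F: "qfact q (2 * Suc n) = qfact q (2 * n) * (1 - w) * (1 - w * q)"
    by (simp add: qfact_Suc w_def mult_ac)
  let ?F = "qfact q (2 * n)"
  have "(1 + w) * central_qbinomial q n j + X * central_qbinomial q n (j - 1) + Y * central_qbinomial q n (j + 1)
      = ?F * ((1 + w) * (inv_qfact q (p - 1) * inv_qfact q (r - 1)) + (X * inv_qfact q (r - 2)) * I + (Y * inv_qfact q (p - 2)) * J)"
    by (simp add: central_qbinomial_def p_def r_def I_def J_def algebra_simps)
  also have "\<dots> = ?F * I * J * ((1 + w) * (1 - X) * (1 - Y) + (1 - Y) * (X - w) + (1 - X) * (Y - w))"
    unfolding A B C by (simp add: algebra_simps)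
  also have "\<dots> = ?F * I * J * ((1 - w) * (1 - X * Y))"
    by (simp add: algebra_simps)
  also have "\<dots> = central_qbinomial q (Suc n) j"
    unfolding XY central_qbinomial_def F by (simp add: p_def r_def I_def J_def mult_ac add_ac)
  finally show ?thesis
    by (simp add: X_def Y_def w_def p_def r_def)
qed

lemma central_qbinomial_eq_0: "\<bar>j\<bar> > int n \<Longrightarrow> central_qbinomial q n j = 0"
  by (auto simp: central_qbinomial_def inv_qfact_def)

text \<open>Induction on \<open>n\<close>: expanding the new pair of factors gives the old sum
  unshifted with weight \<open>1 + q^(2n+1)\<close> and shifted by one in either direction, which
  matches the recurrence \<open>central_qbinomial_Suc\<close>.\<close>

lemma finite_triple_product:
  assumes q: "norm (a * b) < 1"
  shows "(\<Prod>k<n. (1 + a * (a * b) ^ k) * (1 + b * (a * b) ^ k))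
          = (\<Sum>j\<in>{- int n..int n}. rterm a b j * central_qbinomial (a * b) n j)"
proof (induction n)
  case 0
  show ?case by (simp add: rterm_def central_qbinomial_def qfact_def inv_qfact_def)
next
  case (Suc n)
  define q where "q = a * b"
  have q: "norm q < 1" using assms by (simp add: q_def)
  let ?c = "central_qbinomial q"
  let ?J = "{- int (Suc n)..int (Suc n)}"
  define A B where "A = a * q ^ n" and "B = b * q ^ n"
  have AB: "A * B = q ^ (2 * n + 1)"
    by (simp add: A_def B_def q_def power_add mult_ac flip: power_mult_distrib power2_eq_square power_mult)
  \<comment> \<open>All copies of the sum are put on the range for \<open>Suc n\<close>; the added
    terms vanish because the coefficient does for \<open>abs j > n\<close>.\<close>
  have ext: "(\<Sum>j\<in>{- int n..int n}. g j * ?c n j) = (\<Sum>j\<in>?J. g j * ?c n j)" for g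
    by (rule sum.mono_neutral_left) (auto intro!: central_qbinomial_eq_0)
  have shl: "(\<Sum>j\<in>{- int n..int n}. g j * ?c n j) = (\<Sum>j\<in>?J. g (j - 1) * ?c n (j - 1))" for g
  proof -
    have "(\<Sum>j\<in>{- int n..int n}. g j * ?c n j) = (\<Sum>j\<in>{- int n + 1..int n + 1}. g (j - 1) * ?c n (j - 1))"
      by (rule sum.reindex_bij_witness[where i = "\<lambda>j. j - 1" and j = "\<lambda>j. j + 1"]) auto
    also have "\<dots> = (\<Sum>j\<in>?J. g (j - 1) * ?c n (j - 1))"
      by (rule sum.mono_neutral_left) (auto intro!: central_qbinomial_eq_0)
    finally show ?thesis .
  qed
  have shr: "(\<Sum>j\<in>{- int n..int n}. g j * ?c n j) = (\<Sum>j\<in>?J. g (j + 1) * ?c n (j + 1))" for g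
  proof -
    have "(\<Sum>j\<in>{- int n..int n}. g j * ?c n j) = (\<Sum>j\<in>{- int n - 1..int n - 1}. g (j + 1) * ?c n (j + 1))"
      by (rule sum.reindex_bij_witness[where i = "\<lambda>j. j + 1" and j = "\<lambda>j. j - 1"]) auto
    also have "\<dots> = (\<Sum>j\<in>?J. g (j + 1) * ?c n (j + 1))"
      by (rule sum.mono_neutral_left) (auto intro!: central_qbinomial_eq_0)
    finally show ?thesis .
  qed
  let ?P = "\<Sum>j\<in>{- int n..int n}. rterm a b j * ?c n j"
  have "(\<Prod>k<Suc n. (1 + a * q ^ k) * (1 + b * q ^ k)) = ?P * ((1 + A) * (1 + B))"
    using Suc.IH by (simp add: q_def A_def B_def)
  also have "\<dots> = (1 + A * B) * ?P + A * ?P + B * ?P"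
    by (simp add: algebra_simps)
  also have "\<dots> = (\<Sum>j\<in>?J. (1 + A * B) * (rterm a b j * ?c n j))
                + (\<Sum>j\<in>?J. A * (rterm a b (j - 1) * ?c n (j - 1)))
                + (\<Sum>j\<in>?J. B * (rterm a b (j + 1) * ?c n (j + 1)))"
    by (simp only: sum_distrib_left[symmetric] ext[symmetric] shl[symmetric] shr[symmetric])
  also have "\<dots> = (\<Sum>j\<in>?J. rterm a b j * ?c (Suc n) j)"
    unfolding sum.distrib[symmetric]
  proof (intro sum.cong refl)
    fix j assume j: "j \<in> ?J"
    have 1: "rterm a b (j - 1) * A = rterm a b j * q ^ nat (int n + 1 - j)"
      unfolding A_def q_def by (rule rterm_shift_left) (use j in auto)
    have 2: "rterm a b (j + 1) * B = rterm a b j * q ^ nat (int n + 1 + j)"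
      unfolding B_def q_def by (rule rterm_shift_right) (use j in auto)
    have "(1 + A * B) * (rterm a b j * ?c n j) + A * (rterm a b (j - 1) * ?c n (j - 1))
            + B * (rterm a b (j + 1) * ?c n (j + 1))
        = (1 + A * B) * (rterm a b j * ?c n j) + (rterm a b (j - 1) * A) * ?c n (j - 1)
            + (rterm a b (j + 1) * B) * ?c n (j + 1)"
      by (simp add: mult_ac)
    also have "\<dots> = rterm a b j * ((1 + A * B) * ?c n j + q ^ nat (int n + 1 - j) * ?c n (j - 1)
            + q ^ nat (int n + 1 + j) * ?c n (j + 1))"
      unfolding 1 2 by (simp add: algebra_simps)
    also have "\<dots> = rterm a b j * ?c (Suc n) j"
      unfolding AB using j by (subst central_qbinomial_Suc[OF q]) auto
    finally show "(1 + A * B) * (rterm a b j * ?c n j) + A * (rterm a b (j - 1) * ?c n (j - 1))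
            + B * (rterm a b (j + 1) * ?c n (j + 1)) = rterm a b j * ?c (Suc n) j" .
  qed
  finally show ?case by (simp add: q_def)
qed

text \<open>The limit of \<open>finite_triple_product\<close> as \<open>n\<close> grows: each
  central coefficient tends to \<open>1 / E\<close>, and Tannery's theorem interchanges limit and
  sum.\<close>

theorem jacobi_triple_product:
  assumes a: "norm a < 1" and b: "norm b < 1"
  shows "ramanujan_f a b = qpoch (-a) (a * b) * qpoch (-b) (a * b) * qpoch (a * b) (a * b)"
proof -
  define q where "q = a * b"
  have q: "norm q < 1"
    using mult_strict_mono'[OF a b] by (simp add: q_def norm_mult)
  define E where "E = qpoch q q"
  have E: "E \<noteq> 0" unfolding E_def by (intro qpoch_nonzero q)
  have lim: "qfact q \<longlonglongrightarrow> E"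
    unfolding E_def qfact_def[abs_def] by (rule qpoch_tendsto[OF q])
  hence lim': "(\<lambda>n. inverse (qfact q n)) \<longlonglongrightarrow> inverse E"
    using E by (intro tendsto_inverse)
  \<comment> \<open>Both \<open>qfact\<close> and its inverse converge, the limit being nonzero,
    hence are bounded; this bounds the central coefficients uniformly in \<open>n\<close> and
    \<open>j\<close>.\<close>
  obtain K1 where K1: "\<And>n. norm (qfact q n) \<le> K1"
    using convergent_imp_Bseq[OF convergentI[OF lim]] BseqE by (metis (no_types, lifting))
  obtain K2 where K2: "\<And>n. norm (inverse (qfact q n)) \<le> K2"
    using convergent_imp_Bseq[OF convergentI[OF lim']] BseqE by (metis (no_types, lifting))
  have K2nn: "K2 \<ge> 0" using K2[of 0] norm_ge_zero order_trans by blast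
  have K1nn: "K1 \<ge> 0" using K1[of 0] norm_ge_zero order_trans by blast
  have inv_bd: "norm (inv_qfact q m) \<le> K2" for m
    using K2[of "nat m"] K2nn by (simp add: inv_qfact_def divide_inverse)
  have bd: "norm (central_qbinomial q n j) \<le> K1 * K2 * K2" for n j
    unfolding central_qbinomial_def norm_mult
    using K1 inv_bd K1nn K2nn by (intro mult_mono) auto
  define r where "r = max (norm a) (norm b)"
  have r: "0 \<le> r" "r < 1" using a b by (auto simp: r_def le_max_iff_disj)
  have rt: "norm (rterm a b n) \<le> r ^ nat \<bar>n\<bar>" for n
    using r by (intro norm_rterm_le) (auto simp: r_def)
  have cent: "(\<lambda>n. central_qbinomial q n j) \<longlonglongrightarrow> inverse E" for j
  proof -
    have sub: "(\<lambda>n. inv_qfact q (int n + i)) \<longlonglongrightarrow> inverse E" for i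
    proof -
      have "filterlim (\<lambda>n. nat (int n + i)) at_top sequentially"
        unfolding filterlim_at_top
      proof
        fix Z :: nat
        show "eventually (\<lambda>n. Z \<le> nat (int n + i)) sequentially"
          by (intro eventually_sequentiallyI[of "nat (int Z - i)"]) linarith
      qed
      hence "(\<lambda>n. inverse (qfact q (nat (int n + i)))) \<longlonglongrightarrow> inverse E"
        by (rule filterlim_compose[OF lim'])
      moreover have "eventually (\<lambda>n. inverse (qfact q (nat (int n + i))) = inv_qfact q (int n + i)) sequentially"
        by (intro eventually_sequentiallyI[of "nat (-i)"]) (auto simp: inv_qfact_def divide_inverse)
      ultimately show ?thesis by (rule Lim_transform_eventually)
    qed
    have "(\<lambda>n. qfact q (2 * n)) \<longlonglongrightarrow> E"
      using LIMSEQ_subseq_LIMSEQ[OF lim, of "\<lambda>n. 2 * n"] by (simp add: strict_mono_def o_def)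
    hence "(\<lambda>n. qfact q (2 * n) * inv_qfact q (int n + (- j)) * inv_qfact q (int n + j))
              \<longlonglongrightarrow> E * inverse E * inverse E"
      by (intro tendsto_mult sub)
    thus ?thesis using E by (simp add: central_qbinomial_def)
  qed
  \<comment> \<open>Tannery's theorem concerns series indexed by naturals, so the integers are
    enumerated by \<open>int_decode\<close>; \<open>M\<close> is the summable majorant.\<close>
  define M where "M = (\<lambda>k. r ^ nat \<bar>int_decode k\<bar> * (K1 * K2 * K2))"
  have bij: "bij_betw int_decode UNIV UNIV" by (rule bij_int_decode)
  have "((\<lambda>n::int. r ^ nat \<bar>n\<bar>) has_sum (\<Sum>\<^sub>\<infinity>n::int. r ^ nat \<bar>n\<bar>)) UNIV"
    using summable_on_power_abs_int[OF r] by simp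
  hence "((\<lambda>k. r ^ nat \<bar>int_decode k\<bar>) has_sum (\<Sum>\<^sub>\<infinity>n::int. r ^ nat \<bar>n\<bar>)) UNIV"
    using has_sum_reindex_bij_betw[OF bij, of "\<lambda>n. r ^ nat \<bar>n\<bar>"] by simp
  hence M: "summable M"
    unfolding M_def by (intro summable_mult2) (use has_sum_imp_sums sums_summable in blast)
  have tann: "(\<lambda>n. \<Sum>k. rterm a b (int_decode k) * central_qbinomial q n (int_decode k))
          \<longlonglongrightarrow> (\<Sum>k. rterm a b (int_decode k) * inverse E)"
  proof (rule tannerys_theorem[THEN conjunct2, THEN conjunct2])
    show "(\<lambda>n. rterm a b (int_decode k) * central_qbinomial q n (int_decode k)) \<longlonglongrightarrow> rterm a b (int_decode k) * inverse E" for k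
      by (intro tendsto_mult tendsto_const cent)
    show "\<forall>\<^sub>F (k, n) in sequentially \<times>\<^sub>F sequentially.
            norm (rterm a b (int_decode k) * central_qbinomial q n (int_decode k)) \<le> M k"
    proof (rule always_eventually, clarify)
      fix k n
      show "norm (rterm a b (int_decode k) * central_qbinomial q n (int_decode k)) \<le> M k"
        unfolding norm_mult M_def using rt bd r by (intro mult_mono) auto
    qed
  qed (use M in auto)
  have "(\<Sum>k. rterm a b (int_decode k) * inverse E) = ramanujan_f a b * inverse E"
  proof -
    have "((\<lambda>n. rterm a b n * inverse E) has_sum (ramanujan_f a b * inverse E)) UNIV"
      by (intro has_sum_cmult_left has_sum_ramanujan_f a b)
    hence "((\<lambda>k. rterm a b (int_decode k) * inverse E) has_sum (ramanujan_f a b * inverse E)) UNIV"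
      using has_sum_reindex_bij_betw[OF bij, of "\<lambda>n. rterm a b n * inverse E"] by simp
    thus ?thesis using has_sum_imp_sums sums_unique by metis
  qed
  moreover have "(\<Sum>k. rterm a b (int_decode k) * central_qbinomial q n (int_decode k))
                   = (\<Prod>k<n. (1 + a * q ^ k) * (1 + b * q ^ k))" for n
  proof -
    have "((\<lambda>j. rterm a b j * central_qbinomial q n j) has_sum (\<Prod>k<n. (1 + a * q ^ k) * (1 + b * q ^ k))) UNIV"
      using finite_triple_product[of a b n] q unfolding q_def
      by (intro has_sum_finite_neutralI[of "{- int n..int n}"]) (auto intro!: central_qbinomial_eq_0)
    hence "((\<lambda>k. rterm a b (int_decode k) * central_qbinomial q n (int_decode k)) has_sum (\<Prod>k<n. (1 + a * q ^ k) * (1 + b * q ^ k))) UNIV"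
      using has_sum_reindex_bij_betw[OF bij, of "\<lambda>j. rterm a b j * central_qbinomial q n j"] by simp
    thus ?thesis using has_sum_imp_sums sums_unique by metis
  qed
  ultimately have "(\<lambda>n. \<Prod>k<n. (1 + a * q ^ k) * (1 + b * q ^ k)) \<longlonglongrightarrow> ramanujan_f a b * inverse E"
    using tann by simp
  moreover have "(\<lambda>n. \<Prod>k<n. (1 + a * q ^ k) * (1 + b * q ^ k)) \<longlonglongrightarrow> qpoch (-a) q * qpoch (-b) q"
    using tendsto_mult[OF qpoch_tendsto[OF q, of "-a"] qpoch_tendsto[OF q, of "-b"]]
    by (simp add: prod.distrib)
  ultimately have "ramanujan_f a b * inverse E = qpoch (-a) q * qpoch (-b) q"
    using LIMSEQ_unique by blast
  thus ?thesis
    using E by (simp add: field_simps E_def q_def)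
qed

section \<open>Dissections of theta series\<close>

lemma norm_power_lt_1: "norm x < 1 \<Longrightarrow> n > 0 \<Longrightarrow> norm (x ^ n) < 1" for x :: complex
  by (simp add: norm_power power_less_one_iff)

lemma ramanujan_f_commute: "ramanujan_f a b = ramanujan_f b a"
  unfolding ramanujan_f_def
  by (rule infsum_reindex_bij_witness[where i = uminus and j = uminus]) (auto simp: rterm_minus)

text \<open>With the triangular numbers \<open>T = n(n+1)/2\<close> and \<open>T' = n(n-1)/2\<close>
  the exponent is \<open>i T + j T'\<close>, and its double is \<open>k n^2 + l n\<close>. The sign
  comes out as \<open>e^n\<close> because \<open>T + T' = n^2\<close> has the parity of
  \<open>n\<close>.\<close>

lemma has_sum_theta_half:
  fixes x e :: complex and k l :: int
  assumes x: "norm x < 1" and e: "e = 1 \<or> e = -1"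
    and ij: "i > 0" "j > 0" and kl: "k = int i + int j" "l = int i - int j"
  shows "((\<lambda>n. e powi n * x powi ((k * n\<^sup>2 + l * n) div 2)) has_sum ramanujan_f (e * x ^ i) (e * x ^ j)) UNIV"
proof -
  have "(rterm (e * x ^ i) (e * x ^ j) has_sum ramanujan_f (e * x ^ i) (e * x ^ j)) UNIV"
    using x e ij by (intro has_sum_ramanujan_f) (auto simp: norm_mult norm_power power_less_one_iff)
  moreover have "rterm (e * x ^ i) (e * x ^ j) n = e powi n * x powi ((k * n\<^sup>2 + l * n) div 2)" for n
  proof -
    define T T' where "T = nat (n * (n + 1) div 2)" and "T' = nat (n * (n - 1) div 2)"
    have T: "n * (n + 1) = int T * 2" "n * (n - 1) = int T' * 2"
      using pronic_nonneg[of n] unfolding T_def T'_def by (simp_all add: pos_imp_zdiv_nonneg_iff)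
    have "k * n\<^sup>2 + l * n = int i * (n * (n + 1)) + int j * (n * (n - 1))"
      unfolding kl by (simp add: algebra_simps power2_eq_square)
    also have "\<dots> = int (i * T + j * T') * 2"
      unfolding T by (simp add: algebra_simps)
    finally have "k * n\<^sup>2 + l * n = int (i * T + j * T') * 2" .
    hence ex: "(k * n\<^sup>2 + l * n) div 2 = int (i * T + j * T')" by simp
    have e': "e ^ T * e ^ T' = e powi n"
    proof -
      have "e ^ T * e ^ T' = e ^ nat (n * n)"
        unfolding T_def T'_def by (simp only: pronic_half_sum flip: power_add)
      also have "\<dots> = e powi (n * n)" by (simp add: power_int_def)
      also have "\<dots> = e powi n"
        using e by (auto simp: power_int_minus_one_minus power_int_minus_left)
      finally show ?thesis .
    qed
    have "rterm (e * x ^ i) (e * x ^ j) n = (e ^ T * e ^ T') * x ^ (i * T + j * T')"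
      unfolding rterm_def T_def[symmetric] T'_def[symmetric]
      by (simp add: power_mult_distrib power_add mult_ac flip: power_mult)
    thus ?thesis
      unfolding e' ex power_int_of_nat .
  qed
  hence "rterm (e * x ^ i) (e * x ^ j) = (\<lambda>n. e powi n * x powi ((k * n\<^sup>2 + l * n) div 2))"
    by (rule ext)
  ultimately show ?thesis by (simp only:)
qed

lemma has_sum_theta_signed:
  fixes x e :: complex and k l :: int
  assumes x: "norm x < 1" and e: "e = 1 \<or> e = -1"
    and ij: "i > 0" "j > 0" and kl: "int i = k + l" "int j = k - l"
  shows "((\<lambda>n. e powi n * x powi (k * n\<^sup>2 + l * n)) has_sum ramanujan_f (e * x ^ i) (e * x ^ j)) UNIV"
proof -
  have "((2 * k) * n\<^sup>2 + (2 * l) * n) div 2 = k * n\<^sup>2 + l * n" for n :: int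
  proof -
    have "((2 * k) * n\<^sup>2 + (2 * l) * n) = (k * n\<^sup>2 + l * n) * 2" by (simp add: algebra_simps)
    thus ?thesis by simp
  qed
  thus ?thesis
    using has_sum_theta_half[OF x e ij, of "2 * k" "2 * l"] kl by simp
qed

lemma has_sum_theta:
  fixes x :: complex and k l :: int
  assumes x: "norm x < 1" and ij: "i > 0" "j > 0" and kl: "int i = k + l" "int j = k - l"
  shows "((\<lambda>n. x powi (k * n\<^sup>2 + l * n)) has_sum ramanujan_f (x ^ i) (x ^ j)) UNIV"
  using has_sum_theta_signed[OF x, of 1 i j k l] assms by simp

lemma has_sum_theta_minus:
  fixes x :: complex and k l :: int
  assumes x: "norm x < 1" and ij: "i > 0" "j > 0" and kl: "int i = k + l" "int j = k - l"
  shows "((\<lambda>n. (-1) powi n * x powi (k * n\<^sup>2 + l * n)) has_sum ramanujan_f (- (x ^ i)) (- (x ^ j))) UNIV"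
  using has_sum_theta_signed[OF x, of "-1" i j k l] assms by simp

lemma theta_exponent_nonneg: "k * n\<^sup>2 + l * n \<ge> 0" if "\<bar>l\<bar> \<le> k" for k l n :: int
proof -
  have "\<bar>l * n\<bar> \<le> k * n\<^sup>2"
    unfolding abs_mult power2_eq_square using that abs_le_square_int[of n] by (intro mult_mono) auto
  thus ?thesis by linarith
qed

text \<open>Restricting to nonnegative exponents makes the rule valid at \<open>x = 0\<close> as
  well, so that point needs no separate treatment in the dissections.\<close>

lemma power_int_add_nonneg: "m \<ge> 0 \<Longrightarrow> n \<ge> 0 \<Longrightarrow> x powi (m + n) = x powi m * x powi n" for x :: complex
  by (simp add: power_int_def nat_add_distrib power_add)

lemma power_int_theta_mult:
  fixes x :: complex and k l m n k' l' :: int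
  assumes "\<bar>l\<bar> \<le> k" "\<bar>l'\<bar> \<le> k'"
  shows "x powi (k * n\<^sup>2 + l * n) * x powi (k' * m\<^sup>2 + l' * m) = x powi ((k * n\<^sup>2 + l * n) + (k' * m\<^sup>2 + l' * m))"
  using assms by (intro power_int_add_nonneg[symmetric] theta_exponent_nonneg)

section \<open>Splitting sums by residue classes, and theta dissections\<close>

lemma has_sum_int_mod:
  fixes f :: "int \<Rightarrow> complex"
  assumes m: "m > 0" and f: "\<And>r. r \<in> {0..<m} \<Longrightarrow> ((\<lambda>k. f (m * k + r)) has_sum s r) UNIV"
  shows "(f has_sum (\<Sum>r\<in>{0..<m}. s r)) UNIV"
proof -
  have "(f has_sum (\<Sum>r\<in>{0..<m}. s r)) (\<Union>r\<in>{0..<m}. {n. n mod m = r})"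
  proof (rule sum_has_sum)
    fix r assume r: "r \<in> {0..<m}"
    have "((\<lambda>k. f (m * k + r)) has_sum s r) UNIV = (f has_sum s r) {n. n mod m = r}"
      by (rule has_sum_reindex_bij_witness[where i = "\<lambda>n. n div m" and j = "\<lambda>k. m * k + r"])
         (use r m in auto)
    thus "(f has_sum s r) {n. n mod m = r}" using f[OF r] by simp
  qed auto
  moreover have "(\<Union>r\<in>{0..<m}. {n. n mod m = r}) = UNIV"
    using m by auto
  ultimately show ?thesis by simp
qed

lemma has_sum_int_parity:
  fixes f :: "int \<Rightarrow> complex"
  assumes "((\<lambda>k. f (2 * k)) has_sum a) UNIV" "((\<lambda>k. f (2 * k + 1)) has_sum b) UNIV"
  shows "(f has_sum (a + b)) UNIV"
proof -
  have two: "{0..<2} = {0, 1 :: int}" by auto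
  have "(f has_sum (\<Sum>r\<in>{0..<2::int}. if r = 0 then a else b)) UNIV"
    by (rule has_sum_int_mod) (use assms in \<open>auto simp: two\<close>)
  thus ?thesis by (simp add: two)
qed

text \<open>Pairs of equal parity are \<open>(u + v, u - v)\<close>; those of opposite parity are
  the same lattice translated by \<open>(-1, 0)\<close>.\<close>

lemma has_sum_pairs_parity:
  fixes F :: "int \<times> int \<Rightarrow> complex"
  assumes "((\<lambda>(u, v). F (u + v, u - v)) has_sum a) UNIV"
    and "((\<lambda>(u, v). F (u + v - 1, u - v)) has_sum b) UNIV"
  shows "(F has_sum (a + b)) UNIV"
proof -
  have "((\<lambda>(u, v). F (u + v, u - v)) has_sum a) UNIV = (F has_sum a) {(n, m). even (n - m)}"
    by (rule has_sum_reindex_bij_witness[where i = "\<lambda>(n, m). ((n + m) div 2, (n - m) div 2)"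
          and j = "\<lambda>(u, v). (u + v, u - v)"]) (clarsimp, presburger?)+
  moreover have "((\<lambda>(u, v). F (u + v - 1, u - v)) has_sum b) UNIV = (F has_sum b) {(n, m). odd (n - m)}"
    by (rule has_sum_reindex_bij_witness[where i = "\<lambda>(n, m). ((n + m + 1) div 2, (n - m + 1) div 2)"
          and j = "\<lambda>(u, v). (u + v - 1, u - v)"]) (clarsimp, presburger?)+
  ultimately have "(F has_sum (a + b)) ({(n, m). even (n - m)} \<union> {(n, m). odd (n - m)})"
    using assms by (intro has_sum_Un_disjoint) auto
  moreover have "({(n, m). even (n - m)} \<union> {(n, m). odd (n - m)}) = (UNIV :: (int \<times> int) set)" by auto
  ultimately show ?thesis by simp
qed

text \<open>Parity split of \<open>5 n^2 - 2 n\<close>: \<open>n = 2k\<close> gives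
  \<open>20 k^2 - 4 k\<close>, and \<open>n = 2k + 1\<close> gives
  \<open>3 + 20 k^2 + 16 k\<close>.\<close>

lemma ramanujan_f_3_7_dissection:
  assumes x: "norm x < 1"
  shows "ramanujan_f (x ^ 3) (x ^ 7) = ramanujan_f (x ^ 16) (x ^ 24) + x ^ 3 * ramanujan_f (x ^ 4) (x ^ 36)"
proof -
  have "((\<lambda>n. x powi (5 * n\<^sup>2 + (-2) * n)) has_sum (ramanujan_f (x ^ 16) (x ^ 24) + x ^ 3 * ramanujan_f (x ^ 36) (x ^ 4))) UNIV"
  proof (rule has_sum_int_parity)
    show "((\<lambda>k. x powi (5 * (2 * k)\<^sup>2 + (-2) * (2 * k))) has_sum ramanujan_f (x ^ 16) (x ^ 24)) UNIV"
      using has_sum_theta[OF x, of 16 24 20 "-4"] by (simp add: power2_eq_square)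
    have "x powi (5 * (2 * k + 1)\<^sup>2 + (-2) * (2 * k + 1)) = x ^ 3 * x powi (20 * k\<^sup>2 + 16 * k)" for k
    proof -
      have "5 * (2 * k + 1)\<^sup>2 + (-2) * (2 * k + 1) = 3 + (20 * k\<^sup>2 + 16 * k)"
        by (simp add: algebra_simps power2_eq_square)
      thus ?thesis by (simp only: power_int_add_nonneg theta_exponent_nonneg) simp
    qed
    thus "((\<lambda>k. x powi (5 * (2 * k + 1)\<^sup>2 + (-2) * (2 * k + 1))) has_sum x ^ 3 * ramanujan_f (x ^ 36) (x ^ 4)) UNIV"
      using has_sum_cmult_right[OF has_sum_theta[OF x, of 36 4 20 16], of "x ^ 3"] by simp
  qed
  moreover have "((\<lambda>n. x powi (5 * n\<^sup>2 + (-2) * n)) has_sum ramanujan_f (x ^ 3) (x ^ 7)) UNIV"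
    using has_sum_theta[OF x, of 3 7 5 "-2"] by simp
  ultimately show ?thesis
    using has_sum_unique by (fastforce simp: ramanujan_f_commute[of "x ^ 36"] ramanujan_f_commute[of "x ^ 32"])
qed

lemma ramanujan_f_1_9_dissection:
  assumes x: "norm x < 1"
  shows "ramanujan_f x (x ^ 9) = ramanujan_f (x ^ 12) (x ^ 28) + x * ramanujan_f (x ^ 8) (x ^ 32)"
proof -
  have "((\<lambda>n. x powi (5 * n\<^sup>2 + (-4) * n)) has_sum (ramanujan_f (x ^ 12) (x ^ 28) + x * ramanujan_f (x ^ 32) (x ^ 8))) UNIV"
  proof (rule has_sum_int_parity)
    show "((\<lambda>k. x powi (5 * (2 * k)\<^sup>2 + (-4) * (2 * k))) has_sum ramanujan_f (x ^ 12) (x ^ 28)) UNIV"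
      using has_sum_theta[OF x, of 12 28 20 "-8"] by (simp add: power2_eq_square)
    have "x powi (5 * (2 * k + 1)\<^sup>2 + (-4) * (2 * k + 1)) = x * x powi (20 * k\<^sup>2 + 12 * k)" for k
    proof -
      have "5 * (2 * k + 1)\<^sup>2 + (-4) * (2 * k + 1) = 1 + (20 * k\<^sup>2 + 12 * k)"
        by (simp add: algebra_simps power2_eq_square)
      thus ?thesis by (simp only: power_int_add_nonneg theta_exponent_nonneg) simp
    qed
    thus "((\<lambda>k. x powi (5 * (2 * k + 1)\<^sup>2 + (-4) * (2 * k + 1))) has_sum x * ramanujan_f (x ^ 32) (x ^ 8)) UNIV"
      using has_sum_cmult_right[OF has_sum_theta[OF x, of 32 8 20 12], of x] by simp
  qed
  moreover have "((\<lambda>n. x powi (5 * n\<^sup>2 + (-4) * n)) has_sum ramanujan_f x (x ^ 9)) UNIV"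
    using has_sum_theta[OF x, of 1 9 5 "-4"] by simp
  ultimately show ?thesis
    using has_sum_unique by (fastforce simp: ramanujan_f_commute[of "x ^ 36"] ramanujan_f_commute[of "x ^ 32"])
qed

text \<open>Even squares give the first term. The odd numbers \<open>4k + 1\<close> and
  \<open>4k + 3 = 4(k+1) - 1\<close> have squares \<open>1 + 16 k^2 + 8 k\<close> and
  \<open>1 + 16 (k+1)^2 - 8 (k+1)\<close>: two copies of one theta series, hence the factor
  2.\<close>

lemma phi_dissection:
  assumes x: "norm x < 1"
  shows "ramanujan_f x x = ramanujan_f (x ^ 4) (x ^ 4) + 2 * x * ramanujan_f (x ^ 8) (x ^ 24)"
proof -
  let ?b = "x * ramanujan_f (x ^ 24) (x ^ 8) + x * ramanujan_f (x ^ 8) (x ^ 24)"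
  have "((\<lambda>n. x powi (1 * n\<^sup>2 + 0 * n)) has_sum (ramanujan_f (x ^ 4) (x ^ 4) + ?b)) UNIV"
  proof (rule has_sum_int_parity)
    show "((\<lambda>k. x powi (1 * (2 * k)\<^sup>2 + 0 * (2 * k))) has_sum ramanujan_f (x ^ 4) (x ^ 4)) UNIV"
      using has_sum_theta[OF x, of 4 4 4 0] by (simp add: power2_eq_square)
    show "((\<lambda>k. x powi (1 * (2 * k + 1)\<^sup>2 + 0 * (2 * k + 1))) has_sum ?b) UNIV"
    proof (rule has_sum_int_parity)
      have "x powi (1 * (2 * (2 * k) + 1)\<^sup>2 + 0 * (2 * (2 * k) + 1)) = x * x powi (16 * k\<^sup>2 + 8 * k)" for k
      proof -
        have "1 * (2 * (2 * k) + 1)\<^sup>2 + 0 * (2 * (2 * k) + 1) = 1 + (16 * k\<^sup>2 + 8 * k)"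
          by (simp add: algebra_simps power2_eq_square)
        thus ?thesis by (simp only: power_int_add_nonneg theta_exponent_nonneg) simp
      qed
      thus "((\<lambda>k. x powi (1 * (2 * (2 * k) + 1)\<^sup>2 + 0 * (2 * (2 * k) + 1))) has_sum x * ramanujan_f (x ^ 24) (x ^ 8)) UNIV"
        using has_sum_cmult_right[OF has_sum_theta[OF x, of 24 8 16 8], of x] by simp
      have *: "x powi (1 * (2 * (2 * k + 1) + 1)\<^sup>2 + 0 * (2 * (2 * k + 1) + 1)) = x * x powi (16 * (k + 1)\<^sup>2 + (-8) * (k + 1))" for k
      proof -
        have "1 * (2 * (2 * k + 1) + 1)\<^sup>2 + 0 * (2 * (2 * k + 1) + 1) = 1 + (16 * (k + 1)\<^sup>2 + (-8) * (k + 1))"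
          by (simp add: algebra_simps power2_eq_square)
        thus ?thesis by (simp only: power_int_add_nonneg theta_exponent_nonneg) simp
      qed
      have "((\<lambda>k. x * x powi (16 * (k + 1)\<^sup>2 + (-8) * (k + 1))) has_sum x * ramanujan_f (x ^ 8) (x ^ 24)) UNIV
            = ((\<lambda>k. x * x powi (16 * k\<^sup>2 + (-8) * k)) has_sum x * ramanujan_f (x ^ 8) (x ^ 24)) UNIV"
        by (rule has_sum_reindex_bij_witness[where i = "\<lambda>k. k - 1" and j = "\<lambda>k. k + 1"]) auto
      thus "((\<lambda>k. x powi (1 * (2 * (2 * k + 1) + 1)\<^sup>2 + 0 * (2 * (2 * k + 1) + 1))) has_sum x * ramanujan_f (x ^ 8) (x ^ 24)) UNIV"
        unfolding * using has_sum_cmult_right[OF has_sum_theta[OF x, of 8 24 16 "-8"], of x] by simp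
    qed
  qed
  moreover have "((\<lambda>n. x powi (1 * n\<^sup>2 + 0 * n)) has_sum ramanujan_f x x) UNIV"
    using has_sum_theta[OF x, of 1 1 1 0] by simp
  ultimately show ?thesis
    using has_sum_unique by (fastforce simp: ramanujan_f_commute[of "x ^ 24"])
qed

text \<open>Both exponents have quadratic coefficient 5, so \<open>n = u + v\<close>,
  \<open>m = u - v\<close> (with \<open>n\<close> lowered by 1 in the odd class) removes the mixed
  term and each class factors again. The sign \<open>(-1)^m\<close> becomes
  \<open>(-1)^u (-1)^v\<close>.\<close>

lemma ramanujan_f_product_dissection:
  assumes x: "norm x < 1"
  shows "ramanujan_f x (x ^ 9) * ramanujan_f (- (x ^ 3)) (- (x ^ 7))
      = ramanujan_f (- (x ^ 4)) (- (x ^ 16)) * ramanujan_f (- (x ^ 8)) (- (x ^ 12))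
        + x * (ramanujan_f (- (x ^ 6)) (- (x ^ 14)) * ramanujan_f (- (x ^ 2)) (- (x ^ 18)))"
proof -
  define F where "F = (\<lambda>(n, m). x powi (5 * n\<^sup>2 + 4 * n) * ((-1) powi m * x powi (5 * m\<^sup>2 + 2 * m)))"
  have "(F has_sum ramanujan_f (x ^ 9) (x ^ 1) * ramanujan_f (- (x ^ 7)) (- (x ^ 3))) (UNIV \<times> UNIV)"
    unfolding F_def
    by (rule has_sum_times) (rule has_sum_theta has_sum_theta_minus; use x in simp)+
  hence 1: "(F has_sum ramanujan_f (x ^ 9) (x ^ 1) * ramanujan_f (- (x ^ 7)) (- (x ^ 3))) UNIV"
    by simp
  have sgn: "(-1) powi (u - v) = (-1) powi u * ((-1) powi v :: complex)" for u v :: int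
    using power_int_add[of "-1 :: complex" u "-v"] by (simp add: power_int_minus_one_minus)
  have "(F has_sum ramanujan_f (- (x ^ 16)) (- (x ^ 4)) * ramanujan_f (- (x ^ 12)) (- (x ^ 8))
        + x * (ramanujan_f (- (x ^ 6)) (- (x ^ 14)) * ramanujan_f (- (x ^ 2)) (- (x ^ 18)))) UNIV"
  proof (rule has_sum_pairs_parity)
    have "F (u + v, u - v) = (-1) powi u * x powi (10 * u\<^sup>2 + 6 * u) * ((-1) powi v * x powi (10 * v\<^sup>2 + 2 * v))" for u v
    proof -
      have "x powi (5 * (u + v)\<^sup>2 + 4 * (u + v)) * x powi (5 * (u - v)\<^sup>2 + 2 * (u - v))
              = x powi ((5 * (u + v)\<^sup>2 + 4 * (u + v)) + (5 * (u - v)\<^sup>2 + 2 * (u - v)))"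
        by (rule power_int_theta_mult) auto
      also have "(5 * (u + v)\<^sup>2 + 4 * (u + v)) + (5 * (u - v)\<^sup>2 + 2 * (u - v)) = (10 * u\<^sup>2 + 6 * u) + (10 * v\<^sup>2 + 2 * v)"
        by (simp add: algebra_simps power2_eq_square)
      also have "x powi \<dots> = x powi (10 * u\<^sup>2 + 6 * u) * x powi (10 * v\<^sup>2 + 2 * v)"
        by (rule power_int_theta_mult[symmetric]) auto
      finally have "x powi (5 * (u + v)\<^sup>2 + 4 * (u + v)) * x powi (5 * (u - v)\<^sup>2 + 2 * (u - v)) = \<dots>" .
      thus ?thesis unfolding F_def case_prod_conv sgn by (simp only: mult_ac power_int_1_right)
    qed
    moreover have "((\<lambda>(u, v). (-1) powi u * x powi (10 * u\<^sup>2 + 6 * u) * ((-1) powi v * x powi (10 * v\<^sup>2 + 2 * v)))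
        has_sum ramanujan_f (- (x ^ 16)) (- (x ^ 4)) * ramanujan_f (- (x ^ 12)) (- (x ^ 8))) (UNIV \<times> UNIV)"
      by (rule has_sum_times) (rule has_sum_theta_minus; use x in simp)+
    ultimately show "((\<lambda>(u, v). F (u + v, u - v)) has_sum
        ramanujan_f (- (x ^ 16)) (- (x ^ 4)) * ramanujan_f (- (x ^ 12)) (- (x ^ 8))) UNIV"
      by simp
    have "F (u + v - 1, u - v) = x * ((-1) powi u * x powi (10 * u\<^sup>2 + (-4) * u) * ((-1) powi v * x powi (10 * v\<^sup>2 + (-8) * v)))" for u v
    proof -
      have "x powi (5 * (u + v - 1)\<^sup>2 + 4 * (u + v - 1)) * x powi (5 * (u - v)\<^sup>2 + 2 * (u - v))
              = x powi ((5 * (u + v - 1)\<^sup>2 + 4 * (u + v - 1)) + (5 * (u - v)\<^sup>2 + 2 * (u - v)))"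
        by (rule power_int_theta_mult) auto
      also have "(5 * (u + v - 1)\<^sup>2 + 4 * (u + v - 1)) + (5 * (u - v)\<^sup>2 + 2 * (u - v))
              = 1 + ((10 * u\<^sup>2 + (-4) * u) + (10 * v\<^sup>2 + (-8) * v))"
        by (simp add: algebra_simps power2_eq_square)
      also have "x powi \<dots> = x powi 1 * x powi ((10 * u\<^sup>2 + (-4) * u) + (10 * v\<^sup>2 + (-8) * v))"
        by (intro power_int_add_nonneg add_nonneg_nonneg theta_exponent_nonneg) auto
      also have "\<dots> = x powi 1 * (x powi (10 * u\<^sup>2 + (-4) * u) * x powi (10 * v\<^sup>2 + (-8) * v))"
        by (subst power_int_theta_mult) auto
      finally have "x powi (5 * (u + v - 1)\<^sup>2 + 4 * (u + v - 1)) * x powi (5 * (u - v)\<^sup>2 + 2 * (u - v)) = \<dots>" .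
      thus ?thesis unfolding F_def case_prod_conv sgn by (simp only: mult_ac power_int_1_right)
    qed
    moreover have "((\<lambda>(u, v). (-1) powi u * x powi (10 * u\<^sup>2 + (-4) * u) * ((-1) powi v * x powi (10 * v\<^sup>2 + (-8) * v)))
        has_sum ramanujan_f (- (x ^ 6)) (- (x ^ 14)) * ramanujan_f (- (x ^ 2)) (- (x ^ 18))) (UNIV \<times> UNIV)"
      by (rule has_sum_times) (rule has_sum_theta_minus; use x in simp)+
    hence "((\<lambda>(u, v). x * ((-1) powi u * x powi (10 * u\<^sup>2 + (-4) * u) * ((-1) powi v * x powi (10 * v\<^sup>2 + (-8) * v))))
        has_sum x * (ramanujan_f (- (x ^ 6)) (- (x ^ 14)) * ramanujan_f (- (x ^ 2)) (- (x ^ 18)))) (UNIV \<times> UNIV)"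
      unfolding case_prod_unfold by (rule has_sum_cmult_right)
    ultimately show "((\<lambda>(u, v). F (u + v - 1, u - v)) has_sum
        x * (ramanujan_f (- (x ^ 6)) (- (x ^ 14)) * ramanujan_f (- (x ^ 2)) (- (x ^ 18)))) UNIV"
      by simp
  qed
  from has_sum_unique[OF 1 this] show ?thesis
    unfolding ramanujan_f_commute[of "x ^ 9"] ramanujan_f_commute[of "- (x ^ 7)"]
      ramanujan_f_commute[of "- (x ^ 16)"] ramanujan_f_commute[of "- (x ^ 12)"] power_one_right .
qed

section \<open>Rogers-Ramanujan functions\<close>

definition rr_G :: "complex \<Rightarrow> complex" where
  "rr_G q = 1 / (qpoch q (q ^ 5) * qpoch (q ^ 4) (q ^ 5))"

definition rr_H :: "complex \<Rightarrow> complex" where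
  "rr_H q = 1 / (qpoch (q ^ 2) (q ^ 5) * qpoch (q ^ 3) (q ^ 5))"

lemma qpoch_power_nonzero:
  assumes "norm x < 1" "i > 0" "j > 0"
  shows "qpoch (x ^ i) (x ^ j) \<noteq> 0"
  using assms by (intro qpoch_nonzero norm_power_lt_1)

lemma qpoch_minus_power_nonzero:
  assumes "norm x < 1" "i > 0" "j > 0"
  shows "qpoch (- (x ^ i)) (x ^ j) \<noteq> 0"
  using norm_power_lt_1[of x i] assms by (intro qpoch_nonzero norm_power_lt_1) auto

lemma euler_E_nonzero: "norm x < 1 \<Longrightarrow> euler_E x \<noteq> 0"
  unfolding euler_E_eq_qpoch by (intro qpoch_nonzero)

lemma qpoch_split_2:
  assumes "norm x < 1" "j > 0"
  shows "qpoch (x ^ i) (x ^ j) = qpoch (x ^ i) (x ^ (2 * j)) * qpoch (x ^ (i + j)) (x ^ (2 * j))"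
  using qpoch_split[OF norm_power_lt_1[OF assms], of 2 "x ^ i"]
  by (simp add: lessThan_nat_numeral power_add mult_ac flip: power_mult)

lemma qpoch_split_5:
  assumes "norm x < 1" "j > 0"
  shows "qpoch (x ^ i) (x ^ j) = qpoch (x ^ i) (x ^ (5 * j)) * qpoch (x ^ (i + j)) (x ^ (5 * j))
     * qpoch (x ^ (i + 2 * j)) (x ^ (5 * j)) * qpoch (x ^ (i + 3 * j)) (x ^ (5 * j)) * qpoch (x ^ (i + 4 * j)) (x ^ (5 * j))"
proof -
  have 5: "{..<5} = {0, 1, 2, 3, 4 :: nat}" by auto
  show ?thesis
    using qpoch_split[OF norm_power_lt_1[OF assms], of 5 "x ^ i"]
    by (simp add: 5 power_add mult_ac flip: power_mult)
qed

lemma qpoch_split_minus: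
  assumes "norm x < 1" "j > 0"
  shows "qpoch (x ^ i) (- (x ^ j)) = qpoch (x ^ i) (x ^ (2 * j)) * qpoch (- (x ^ (i + j))) (x ^ (2 * j))"
    and "qpoch (- (x ^ i)) (- (x ^ j)) = qpoch (- (x ^ i)) (x ^ (2 * j)) * qpoch (x ^ (i + j)) (x ^ (2 * j))"
  using qpoch_split[of "- (x ^ j)" 2 "x ^ i"] qpoch_split[of "- (x ^ j)" 2 "- (x ^ i)"] norm_power_lt_1[OF assms]
  by (simp_all add: lessThan_nat_numeral power_add mult_ac flip: power_mult)

lemma qpoch_mult_minus_power:
  assumes "norm x < 1" "j > 0"
  shows "qpoch (x ^ i) (x ^ j) * qpoch (- (x ^ i)) (x ^ j) = qpoch (x ^ (2 * i)) (x ^ (2 * j))"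
  using qpoch_mult_minus[OF norm_power_lt_1[OF assms], of "x ^ i"]
  by (simp add: mult.commute flip: power_mult)

lemma euler_E_power: "euler_E (x ^ j) = qpoch (x ^ j) (x ^ j)"
  by (rule euler_E_eq_qpoch)

lemma ramanujan_f_power_eq:
  assumes "norm x < 1" "i > 0" "j > 0"
  shows "ramanujan_f (x ^ i) (x ^ j) = qpoch (- (x ^ i)) (x ^ (i + j)) * qpoch (- (x ^ j)) (x ^ (i + j)) * qpoch (x ^ (i + j)) (x ^ (i + j))"
    and "ramanujan_f (- (x ^ i)) (- (x ^ j)) = qpoch (x ^ i) (x ^ (i + j)) * qpoch (x ^ j) (x ^ (i + j)) * qpoch (x ^ (i + j)) (x ^ (i + j))"
  using norm_power_lt_1[of x i] norm_power_lt_1[of x j] assms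
  by (simp_all add: jacobi_triple_product power_add)

section \<open>Theta functions expressed through Rogers-Ramanujan functions\<close>

context
  fixes x :: complex
  assumes x: "norm x < 1"
begin

lemmas qpoch_nz = qpoch_power_nonzero[OF x] qpoch_minus_power_nonzero[OF x]

lemma euler_E_2_mod_10:
  "euler_E (x ^ 2) = qpoch (x ^ 2) (x ^ 10) * qpoch (x ^ 4) (x ^ 10) * qpoch (x ^ 6) (x ^ 10) * qpoch (x ^ 8) (x ^ 10) * qpoch (x ^ 10) (x ^ 10)"
  using qpoch_split_5[OF x, of 2 2] by (simp add: euler_E_power)

lemma rr_G_mod_10:
  "rr_G x = 1 / (qpoch (x ^ 1) (x ^ 10) * qpoch (x ^ 6) (x ^ 10) * (qpoch (x ^ 4) (x ^ 10) * qpoch (x ^ 9) (x ^ 10)))"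
  using qpoch_split_2[OF x, of 5 1] qpoch_split_2[OF x, of 5 4] by (simp add: rr_G_def)

lemma rr_H_mod_10:
  "rr_H x = 1 / (qpoch (x ^ 2) (x ^ 10) * qpoch (x ^ 7) (x ^ 10) * (qpoch (x ^ 3) (x ^ 10) * qpoch (x ^ 8) (x ^ 10)))"
  using qpoch_split_2[OF x, of 5 2] qpoch_split_2[OF x, of 5 3] by (simp add: rr_H_def)

lemma rr_G_minus_mod_10:
  "rr_G (-x) = 1 / (qpoch (- (x ^ 1)) (x ^ 10) * qpoch (x ^ 6) (x ^ 10) * (qpoch (x ^ 4) (x ^ 10) * qpoch (- (x ^ 9)) (x ^ 10)))"
  using qpoch_split_minus[OF x, of 5 1] qpoch_split_minus[OF x, of 5 4] by (simp add: rr_G_def)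

lemma rr_H_minus_mod_10:
  "rr_H (-x) = 1 / (qpoch (x ^ 2) (x ^ 10) * qpoch (- (x ^ 7)) (x ^ 10) * (qpoch (- (x ^ 3)) (x ^ 10) * qpoch (x ^ 8) (x ^ 10)))"
  using qpoch_split_minus[OF x, of 5 2] qpoch_split_minus[OF x, of 5 3] by (simp add: rr_H_def)

lemma rr_G_4: "rr_G (x ^ 4) = 1 / (qpoch (x ^ 4) (x ^ 20) * qpoch (x ^ 16) (x ^ 20))"
  by (simp add: rr_G_def flip: power_mult)

lemma rr_H_4: "rr_H (x ^ 4) = 1 / (qpoch (x ^ 8) (x ^ 20) * qpoch (x ^ 12) (x ^ 20))"
  by (simp add: rr_H_def flip: power_mult)

lemma qpoch_mod_20:
  "qpoch (x ^ 2) (x ^ 10) = qpoch (x ^ 2) (x ^ 20) * qpoch (x ^ 12) (x ^ 20)"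
  "qpoch (x ^ 4) (x ^ 10) = qpoch (x ^ 4) (x ^ 20) * qpoch (x ^ 14) (x ^ 20)"
  "qpoch (x ^ 6) (x ^ 10) = qpoch (x ^ 6) (x ^ 20) * qpoch (x ^ 16) (x ^ 20)"
  "qpoch (x ^ 8) (x ^ 10) = qpoch (x ^ 8) (x ^ 20) * qpoch (x ^ 18) (x ^ 20)"
  "qpoch (x ^ 10) (x ^ 10) = qpoch (x ^ 10) (x ^ 20) * qpoch (x ^ 20) (x ^ 20)"
  using qpoch_split_2[OF x, of 10] by simp_all

text \<open>Products at negative arguments are rewritten by positive ones, so that the evaluations
  below become cancellations among products over residue classes modulo 10 and 20.\<close>

lemma qpoch_minus_mod_10:
  "i > 0 \<Longrightarrow> qpoch (- (x ^ i)) (x ^ 10) = qpoch (x ^ (2 * i)) (x ^ 20) / qpoch (x ^ i) (x ^ 10)"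
  using qpoch_mult_minus_power[OF x, of 10 i] qpoch_nz(1)[of i 10] by (simp add: field_simps)

lemma ramanujan_f_3_7: "ramanujan_f (x ^ 3) (x ^ 7) = euler_E (x ^ 2) * rr_H x * rr_G (x ^ 4)"
  unfolding ramanujan_f_power_eq(1)[OF x, of 3 7, simplified] euler_E_2_mod_10 rr_H_mod_10 rr_G_4
  by (simp add: qpoch_minus_mod_10 qpoch_mod_20 qpoch_nz divide_simps)

lemma ramanujan_f_1_9: "ramanujan_f x (x ^ 9) = euler_E (x ^ 2) * rr_G x * rr_H (x ^ 4)"
  unfolding ramanujan_f_power_eq(1)[OF x, of 1 9, simplified] euler_E_2_mod_10 rr_G_mod_10 rr_H_4
  using qpoch_nz(1)[of 1 10]
  by (simp add: qpoch_minus_mod_10[of 1, simplified] qpoch_minus_mod_10 qpoch_mod_20 qpoch_nz divide_simps)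

lemma ramanujan_f_4_6: "ramanujan_f (x ^ 4) (x ^ 6) = euler_E (x ^ 2) * rr_G x * rr_G (-x)"
  unfolding ramanujan_f_power_eq(1)[OF x, of 4 6, simplified] euler_E_2_mod_10 rr_G_mod_10 rr_G_minus_mod_10
  using qpoch_nz(1)[of 1 10]
  by (simp add: qpoch_minus_mod_10[of 1, simplified] qpoch_minus_mod_10 qpoch_mod_20 qpoch_nz divide_simps)

lemma ramanujan_f_2_8: "ramanujan_f (x ^ 2) (x ^ 8) = euler_E (x ^ 2) * rr_H x * rr_H (-x)"
  unfolding ramanujan_f_power_eq(1)[OF x, of 2 8, simplified] euler_E_2_mod_10 rr_H_mod_10 rr_H_minus_mod_10
  by (simp add: qpoch_minus_mod_10 qpoch_mod_20 qpoch_nz divide_simps)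

text \<open>Ramanujan's \<open>psi(x) = E(x^2)^2 / E(x)\<close>. Multiplying by \<open>E(x)\<close>
  pairs the classes 1 and 3 modulo 4 with their sign changes, and together these give the class 2
  modulo 4.\<close>

lemma ramanujan_f_psi: "ramanujan_f x (x ^ 3) * euler_E x = euler_E (x ^ 2) ^ 2"
proof -
  have 1: "euler_E x = qpoch (x ^ 1) (x ^ 4) * qpoch (x ^ 3) (x ^ 4) * (qpoch (x ^ 2) (x ^ 4) * qpoch (x ^ 4) (x ^ 4))"
    using qpoch_split_2[OF x, of 1 1] qpoch_split_2[OF x, of 2 1] qpoch_split_2[OF x, of 2 2] by (simp add: euler_E_eq_qpoch power2_eq_square power3_eq_cube mult_ac)
  have 2: "euler_E (x ^ 2) = qpoch (x ^ 2) (x ^ 4) * qpoch (x ^ 4) (x ^ 4)"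
    using qpoch_split_2[OF x, of 2 2] by (simp add: euler_E_power)
  have 3: "qpoch (x ^ 2) (x ^ 4) = qpoch (x ^ 2) (x ^ 8) * qpoch (x ^ 6) (x ^ 8)"
    using qpoch_split_2[OF x, of 4 2] by simp
  have "ramanujan_f x (x ^ 3) * euler_E x
     = (qpoch (x ^ 1) (x ^ 4) * qpoch (- (x ^ 1)) (x ^ 4)) * (qpoch (x ^ 3) (x ^ 4) * qpoch (- (x ^ 3)) (x ^ 4))
       * (qpoch (x ^ 4) (x ^ 4) * (qpoch (x ^ 2) (x ^ 4) * qpoch (x ^ 4) (x ^ 4)))"
    unfolding 1 using ramanujan_f_power_eq(1)[OF x, of 1 3] by (simp add: mult_ac)
  also have "\<dots> = qpoch (x ^ 2) (x ^ 4) * (qpoch (x ^ 4) (x ^ 4) * (qpoch (x ^ 2) (x ^ 4) * qpoch (x ^ 4) (x ^ 4)))"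
    unfolding qpoch_mult_minus_power[OF x zero_less_numeral] using 3 by simp
  also have "\<dots> = euler_E (x ^ 2) ^ 2"
    unfolding 2 by (simp add: power2_eq_square mult_ac)
  finally show ?thesis .
qed

text \<open>Only factors with odd exponent change sign, and each of them times its counterpart in
  \<open>E(x)\<close> is \<open>1 - x^(2k)\<close> with \<open>k\<close> odd.\<close>

lemma euler_E_minus: "euler_E (-x) * (euler_E x * euler_E (x ^ 4)) = euler_E (x ^ 2) ^ 3"
proof -
  have "euler_E (-x) = qpoch (- (x ^ 1)) (x ^ 2) * qpoch (x ^ 2) (x ^ 2)"
    using qpoch_split_minus(2)[OF x, of 1 1] by (simp add: euler_E_eq_qpoch power2_eq_square)
  moreover have "euler_E x = qpoch (x ^ 1) (x ^ 2) * qpoch (x ^ 2) (x ^ 2)"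
    using qpoch_split_2[OF x, of 1 1] by (simp add: euler_E_eq_qpoch power2_eq_square)
  ultimately have "euler_E (-x) * euler_E x = (qpoch (x ^ 1) (x ^ 2) * qpoch (- (x ^ 1)) (x ^ 2)) * euler_E (x ^ 2) ^ 2"
    by (simp add: euler_E_power[of x 2] power2_eq_square[of "qpoch _ _"] mult_ac)
  also have "qpoch (x ^ 1) (x ^ 2) * qpoch (- (x ^ 1)) (x ^ 2) = qpoch (x ^ 2) (x ^ 4)"
    using qpoch_mult_minus_power[OF x, of 2 1] by simp
  finally have "euler_E (-x) * euler_E x = qpoch (x ^ 2) (x ^ 4) * euler_E (x ^ 2) ^ 2" .
  moreover have "euler_E (x ^ 2) = qpoch (x ^ 2) (x ^ 4) * euler_E (x ^ 4)"
    using qpoch_split_2[OF x, of 2 2] by (simp add: euler_E_power)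
  ultimately show ?thesis by (simp add: power2_eq_square power3_eq_cube)
qed

lemma ramanujan_f_rr: 
  "ramanujan_f (- (x ^ 2)) (- (x ^ 3)) = euler_E x * rr_G x"
  "ramanujan_f (- x) (- (x ^ 4)) = euler_E x * rr_H x"
proof -
  have E: "euler_E x = qpoch (x ^ 1) (x ^ 5) * qpoch (x ^ 2) (x ^ 5) * qpoch (x ^ 3) (x ^ 5) * qpoch (x ^ 4) (x ^ 5) * qpoch (x ^ 5) (x ^ 5)"
    using qpoch_split_5[OF x, of 1 1] by (simp add: euler_E_eq_qpoch power2_eq_square power3_eq_cube mult_ac)
  show "ramanujan_f (- (x ^ 2)) (- (x ^ 3)) = euler_E x * rr_G x"
    unfolding E rr_G_def using ramanujan_f_power_eq(2)[OF x, of 2 3] qpoch_nz(1)[of 1 5]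
    by (simp add: qpoch_nz divide_simps)
  show "ramanujan_f (- x) (- (x ^ 4)) = euler_E x * rr_H x"
    unfolding E rr_H_def using ramanujan_f_power_eq(2)[OF x, of 1 4]
    by (simp add: qpoch_nz divide_simps)
qed

text \<open>Euler's pentagonal number theorem: the three factors of the triple product are the
  residue classes modulo 3 of \<open>E(x)\<close>.\<close>

lemma euler_E_theta: "ramanujan_f (- x) (- (x ^ 2)) = euler_E x"
proof -
  have "qpoch x (x ^ 1) = (\<Prod>i<3. qpoch (x * x ^ i) (x ^ 3))"
    using qpoch_split[OF x, of 3 x] by simp
  thus ?thesis using ramanujan_f_power_eq(2)[OF x, of 1 2]
    by (simp add: euler_E_eq_qpoch lessThan_nat_numeral eval_nat_numeral mult_ac)
qed

end

section \<open>Watson's dissections and a dissected product\<close>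

text \<open>Multiplied by \<open>rr_H (x^4)\<close> the left side is \<open>f(x, x^9)\<close>. Its
  dissection consists of theta functions in \<open>x^4\<close> that both contain
  \<open>rr_H (x^4)\<close> again, which then cancels.\<close>

lemma rr_G_dissection:
  assumes x: "norm x < 1"
  shows "euler_E (x ^ 2) * rr_G x = euler_E (x ^ 8) * (rr_G (x ^ 16) + x * rr_H (- (x ^ 4)))"
proof -
  have x4: "norm (x ^ 4) < 1" using x by (intro norm_power_lt_1) auto
  have nz: "rr_H (x ^ 4) \<noteq> 0"
    unfolding rr_H_4 [OF x] using qpoch_power_nonzero[OF x] by simp
  have "rr_H (x ^ 4) * (euler_E (x ^ 2) * rr_G x) = ramanujan_f x (x ^ 9)"
    by (simp add: ramanujan_f_1_9[OF x])
  also have "\<dots> = ramanujan_f ((x ^ 4) ^ 3) ((x ^ 4) ^ 7) + x * ramanujan_f ((x ^ 4) ^ 2) ((x ^ 4) ^ 8)"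
    using ramanujan_f_1_9_dissection[OF x] by (simp flip: power_mult)
  also have "\<dots> = rr_H (x ^ 4) * (euler_E (x ^ 8) * (rr_G (x ^ 16) + x * rr_H (- (x ^ 4))))"
    unfolding ramanujan_f_3_7[OF x4] ramanujan_f_2_8[OF x4] by (simp add: algebra_simps flip: power_mult)
  finally show ?thesis using nz by simp
qed

text \<open>The companion from \<open>f(x^3, x^7)\<close>, with \<open>rr_G (x^4)\<close> as the
  common factor.\<close>

lemma rr_H_dissection:
  assumes x: "norm x < 1"
  shows "euler_E (x ^ 2) * rr_H x = euler_E (x ^ 8) * (rr_G (- (x ^ 4)) + x ^ 3 * rr_H (x ^ 16))"
proof -
  have x4: "norm (x ^ 4) < 1" using x by (intro norm_power_lt_1) auto
  have nz: "rr_G (x ^ 4) \<noteq> 0"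
    unfolding rr_G_4 [OF x] using qpoch_power_nonzero[OF x] by simp
  have "rr_G (x ^ 4) * (euler_E (x ^ 2) * rr_H x) = ramanujan_f (x ^ 3) (x ^ 7)"
    by (simp add: ramanujan_f_3_7[OF x])
  also have "\<dots> = ramanujan_f ((x ^ 4) ^ 4) ((x ^ 4) ^ 6) + x ^ 3 * ramanujan_f (x ^ 4) ((x ^ 4) ^ 9)"
    using ramanujan_f_3_7_dissection[OF x] by (simp flip: power_mult)
  also have "\<dots> = rr_G (x ^ 4) * (euler_E (x ^ 8) * (rr_G (- (x ^ 4)) + x ^ 3 * rr_H (x ^ 16)))"
    unfolding ramanujan_f_4_6[OF x4] ramanujan_f_1_9[OF x4] by (simp add: algebra_simps flip: power_mult)
  finally show ?thesis using nz by simp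
qed

text \<open>With \<open>psi(y) = f(y, y^3)\<close> the right side is
  \<open>psi(x^2) + x psi(x^10)\<close>. After multiplication by \<open>K\<close> the claim becomes
  \<open>ramanujan_f_product_dissection\<close>.\<close>

lemma rr_GH_product_dissection:
  assumes x: "norm x < 1"
  shows "euler_E (x ^ 2) * (rr_G x * rr_H (-x))
      = ramanujan_f (x ^ 2) (x ^ 6) + x * ramanujan_f (x ^ 10) (x ^ 30)"
proof -
  note nz = qpoch_power_nonzero[OF x] qpoch_minus_power_nonzero[OF x]
  \<comment> \<open>\<open>K\<close> is the ratio of \<open>f(x, x^9) f(-x^3, -x^7)\<close> to the
    left side; each theta product of the dissection is \<open>K\<close> times a value of
    \<open>psi\<close>.\<close>
  define K where "K = qpoch (x ^ 10) (x ^ 10) * qpoch (x ^ 2) (x ^ 20) * qpoch (x ^ 6) (x ^ 20)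
                        * qpoch (x ^ 14) (x ^ 20) * qpoch (x ^ 18) (x ^ 20)"
  have K: "K \<noteq> 0" unfolding K_def by (simp add: nz)
  have x2: "norm (x ^ 2) < 1" and x10: "norm (x ^ 10) < 1" using x by (auto intro!: norm_power_lt_1)
  have E2: "euler_E (x ^ 2) \<noteq> 0" "euler_E (x ^ 10) \<noteq> 0"
    by (intro euler_E_nonzero x2 x10)+
  have lhs: "K * (euler_E (x ^ 2) * (rr_G x * rr_H (-x)))
      = ramanujan_f x (x ^ 9) * ramanujan_f (- (x ^ 3)) (- (x ^ 7))"
    unfolding K_def ramanujan_f_power_eq(1)[OF x, of 1 9, simplified] ramanujan_f_power_eq(2)[OF x, of 3 7, simplified]
      euler_E_2_mod_10[OF x] rr_G_mod_10[OF x] rr_H_minus_mod_10[OF x]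
    using nz(1)[of 1 10]
    by (simp add: qpoch_minus_mod_10[OF x, of 1, simplified] qpoch_minus_mod_10[OF x] nz divide_simps)
  have E20: "euler_E (x ^ 20) = qpoch (x ^ 20) (x ^ 20)"
    by (rule euler_E_power)
  have E4: "euler_E (x ^ 4) = qpoch (x ^ 4) (x ^ 20) * qpoch (x ^ 8) (x ^ 20) * qpoch (x ^ 12) (x ^ 20) * qpoch (x ^ 16) (x ^ 20) * qpoch (x ^ 20) (x ^ 20)"
    using qpoch_split_5[OF x, of 4 4] by (simp add: euler_E_power)
  have psi2: "ramanujan_f (x ^ 2) (x ^ 6) = euler_E (x ^ 4) * euler_E (x ^ 4) / euler_E (x ^ 2)"
    using ramanujan_f_psi[OF x2] E2 by (simp add: eq_divide_eq flip: power_mult) (simp add: power2_eq_square)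
  have psi10: "ramanujan_f (x ^ 10) (x ^ 30) = euler_E (x ^ 20) * euler_E (x ^ 20) / euler_E (x ^ 10)"
    using ramanujan_f_psi[OF x10] E2 by (simp add: eq_divide_eq flip: power_mult) (simp add: power2_eq_square)
  have p1: "ramanujan_f (- (x ^ 4)) (- (x ^ 16)) * ramanujan_f (- (x ^ 8)) (- (x ^ 12)) = K * ramanujan_f (x ^ 2) (x ^ 6)"
    unfolding psi2 ramanujan_f_power_eq(2)[OF x, of 4 16, simplified] ramanujan_f_power_eq(2)[OF x, of 8 12, simplified]
      E4 euler_E_2_mod_10[OF x] K_def
    by (simp add: qpoch_mod_20[OF x] nz divide_simps)
  have p2: "ramanujan_f (- (x ^ 6)) (- (x ^ 14)) * ramanujan_f (- (x ^ 2)) (- (x ^ 18)) = K * ramanujan_f (x ^ 10) (x ^ 30)"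
    unfolding psi10 ramanujan_f_power_eq(2)[OF x, of 6 14, simplified] ramanujan_f_power_eq(2)[OF x, of 2 18, simplified]
      E20 K_def euler_E_power[of x 10]
    by (simp add: nz divide_simps)
  have "K * (euler_E (x ^ 2) * (rr_G x * rr_H (-x))) = K * (ramanujan_f (x ^ 2) (x ^ 6) + x * ramanujan_f (x ^ 10) (x ^ 30))"
    unfolding lhs ramanujan_f_product_dissection[OF x] p1 p2 by (simp add: algebra_simps)
  thus ?thesis using K by simp
qed

section \<open>The functions phi(q) and phi(q^5)\<close>

text \<open>The bound depends on \<open>a\<close> and \<open>q\<close> only through their norms, so
  it yields limits when argument and base move to 0 together.\<close>

lemma norm_qpoch_minus_1_le:
  assumes q: "norm q < 1"
  shows "norm (qpoch a q - 1) \<le> exp (norm a / (1 - norm q)) - 1"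
proof (rule LIMSEQ_le_const2)
  show "(\<lambda>n. norm ((\<Prod>k<n. 1 - a * q ^ k) - 1)) \<longlonglongrightarrow> norm (qpoch a q - 1)"
    by (intro tendsto_norm tendsto_diff qpoch_tendsto q tendsto_const)
  have "norm ((\<Prod>k<n. 1 - a * q ^ k) - 1) \<le> exp (norm a / (1 - norm q)) - 1" for n
  proof -
    have "norm ((\<Prod>k<n. 1 + (- (a * q ^ k))) - 1) \<le> (\<Prod>k<n. 1 + norm (- (a * q ^ k))) - 1"
      by (rule norm_prod_minus1_le_prod_minus1)
    also have "(\<Prod>k<n. 1 + norm (- (a * q ^ k))) \<le> exp (\<Sum>k<n. norm (- (a * q ^ k)))"
      by (rule prod_le_exp_sum) auto
    also have "(\<Sum>k<n. norm (- (a * q ^ k))) = norm a * (\<Sum>k<n. norm q ^ k)"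
      by (simp add: norm_mult norm_power sum_distrib_left)
    also have "\<dots> \<le> norm a * (1 / (1 - norm q))"
      using q sum_le_suminf[OF summable_geometric[of "norm q"], of "{..<n}"]
      by (intro mult_left_mono) (auto simp: suminf_geometric)
    finally show ?thesis by simp
  qed
  thus "\<exists>N. \<forall>n\<ge>N. norm ((\<Prod>k<n. 1 - a * q ^ k) - 1) \<le> exp (norm a / (1 - norm q)) - 1"
    by blast
qed

lemma tendsto_qpoch_1:
  assumes f: "(f \<longlongrightarrow> 0) F" and g: "(g \<longlongrightarrow> 0) F"
  shows "((\<lambda>x. qpoch (f x) (g x)) \<longlongrightarrow> 1) F"
proof -
  have lim: "((\<lambda>x. exp (norm (f x) / (1 - norm (g x))) - 1) \<longlongrightarrow> exp (norm (0 :: complex) / (1 - norm (0 :: complex))) - 1) F"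
    by (intro tendsto_intros f g) auto
  have "eventually (\<lambda>x. norm (g x) < 1) F"
    using order_tendstoD(2)[OF tendsto_norm[OF g], of 1] by simp
  hence "eventually (\<lambda>x. norm (qpoch (f x) (g x) - 1) \<le> exp (norm (f x) / (1 - norm (g x))) - 1) F"
    by eventually_elim (rule norm_qpoch_minus_1_le)
  hence "((\<lambda>x. qpoch (f x) (g x) - 1) \<longlongrightarrow> 0) F"
    by (rule Lim_null_comparison) (use lim in simp)
  thus ?thesis by (simp add: LIM_zero_iff)
qed

text \<open>Iteration gives \<open>g x = g (x^(4^n))\<close>, and these points tend to 0. The filter
  \<open>nhds 0\<close> includes the origin, so the case \<open>x = 0\<close> is covered.\<close>

lemma eq_limit_at_0_of_power_invariant:
  fixes g :: "complex \<Rightarrow> complex"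
  assumes inv: "\<And>x. norm x < 1 \<Longrightarrow> g x = g (x ^ 4)" and lim: "(g \<longlongrightarrow> L) (nhds 0)" and x: "norm x < 1"
  shows "g x = L"
proof -
  have "g (x ^ (4 ^ n)) = g x" for n
  proof (induction n)
    case (Suc n)
    have "g (x ^ (4 ^ n)) = g ((x ^ (4 ^ n)) ^ 4)"
      using x by (intro inv norm_power_lt_1) auto
    thus ?case using Suc.IH by (simp add: mult.commute flip: power_mult)
  qed simp
  moreover have "(\<lambda>n. x ^ (4 ^ n)) \<longlonglongrightarrow> 0"
  proof -
    have "strict_mono (\<lambda>n. 4 ^ n :: nat)" by (rule strict_monoI) simp
    from LIMSEQ_subseq_LIMSEQ[OF LIMSEQ_power_zero[OF x] this] show ?thesis by (simp add: o_def)
  qed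
  hence "(\<lambda>n. g (x ^ (4 ^ n))) \<longlonglongrightarrow> L"
    using filterlim_compose[OF lim] by blast
  ultimately have "(\<lambda>n::nat. g x) \<longlonglongrightarrow> L" by simp
  thus ?thesis by (simp add: LIMSEQ_const_iff)
qed

lemma tendsto_power_nhds_0: "n > 0 \<Longrightarrow> ((\<lambda>x::complex. x ^ n) \<longlongrightarrow> 0) (nhds 0)"
  using tendsto_power[OF filterlim_ident[of "nhds (0::complex)"], of n] by (simp add: power_0_left)

lemma tendsto_qpoch_power:
  assumes "i > 0" "j > 0"
  shows "((\<lambda>x. qpoch (x ^ i) (x ^ j)) \<longlongrightarrow> 1) (nhds 0)" "((\<lambda>x. qpoch (- (x ^ i)) (x ^ j)) \<longlongrightarrow> 1) (nhds 0)"
  using tendsto_minus[OF tendsto_power_nhds_0[OF assms(1)]] tendsto_power_nhds_0[OF assms(1)] tendsto_power_nhds_0[OF assms(2)]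
  by (auto intro!: tendsto_qpoch_1)

lemma tendsto_rr:
  assumes "i > 0"
  shows "((\<lambda>x. rr_G (x ^ i)) \<longlongrightarrow> 1) (nhds 0)" "((\<lambda>x. rr_H (x ^ i)) \<longlongrightarrow> 1) (nhds 0)"
    "((\<lambda>x. euler_E (x ^ i)) \<longlongrightarrow> 1) (nhds 0)"
proof -
  have "((\<lambda>x. 1 / (qpoch (x ^ i) (x ^ (i * 5)) * qpoch (x ^ (i * 4)) (x ^ (i * 5)))) \<longlongrightarrow> 1 / (1 * 1)) (nhds 0)"
    using assms by (intro tendsto_intros tendsto_qpoch_power) auto
  thus "((\<lambda>x. rr_G (x ^ i)) \<longlongrightarrow> 1) (nhds 0)" by (simp add: rr_G_def flip: power_mult)
  have "((\<lambda>x. 1 / (qpoch (x ^ (i * 2)) (x ^ (i * 5)) * qpoch (x ^ (i * 3)) (x ^ (i * 5)))) \<longlongrightarrow> 1 / (1 * 1)) (nhds 0)"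
    using assms by (intro tendsto_intros tendsto_qpoch_power) auto
  thus "((\<lambda>x. rr_H (x ^ i)) \<longlongrightarrow> 1) (nhds 0)" by (simp add: rr_H_def flip: power_mult)
  show "((\<lambda>x. euler_E (x ^ i)) \<longlongrightarrow> 1) (nhds 0)"
    unfolding euler_E_eq_qpoch using assms by (intro tendsto_qpoch_power) auto
qed

lemma tendsto_phi:
  assumes "i > 0"
  shows "((\<lambda>x. ramanujan_f (x ^ i) (x ^ i)) \<longlongrightarrow> 1) (nhds 0)"
proof -
  have "((\<lambda>x. qpoch (- (x ^ i)) (x ^ (i + i)) * qpoch (- (x ^ i)) (x ^ (i + i)) * qpoch (x ^ (i + i)) (x ^ (i + i))) \<longlongrightarrow> 1 * 1 * 1) (nhds 0)"
    using assms by (intro tendsto_intros tendsto_qpoch_power) auto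
  moreover have "eventually (\<lambda>x::complex. x \<in> ball 0 1) (nhds 0)"
    by (intro eventually_nhds_in_open) auto
  hence "eventually (\<lambda>x. qpoch (- (x ^ i)) (x ^ (i + i)) * qpoch (- (x ^ i)) (x ^ (i + i)) * qpoch (x ^ (i + i)) (x ^ (i + i))
            = ramanujan_f (x ^ i) (x ^ i)) (nhds 0)"
    by eventually_elim (use assms in \<open>simp add: ramanujan_f_power_eq(1)\<close>)
  ultimately show ?thesis
    by (simp add: filterlim_cong)
qed

text \<open>Watson's dissections are applied to the values at \<open>x\<close> only; since
  \<open>x * x^3 = x^4\<close> the same expression reappears at \<open>x^4\<close>, plus two mixed
  products. The value \<open>s = 1\<close> serves \<open>phi(x)\<close>, and \<open>s = -1\<close>
  serves \<open>phi(x^5)\<close>.\<close>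

lemma rr_phi_step:
  assumes x: "norm x < 1"
  shows "euler_E (x ^ 2) * (rr_G x * rr_G (x ^ 4) + s * x * (rr_H x * rr_H (x ^ 4)))
     = euler_E (x ^ 8) * (rr_G (x ^ 4) * rr_G (x ^ 16) + s * x ^ 4 * (rr_H (x ^ 4) * rr_H (x ^ 16)))
       + x * (euler_E (x ^ 8) * (rr_G (x ^ 4) * rr_H (- (x ^ 4))) + s * (euler_E (x ^ 8) * (rr_G (- (x ^ 4)) * rr_H (x ^ 4))))"
proof -
  have "euler_E (x ^ 2) * (rr_G x * rr_G (x ^ 4) + s * x * (rr_H x * rr_H (x ^ 4)))
      = (euler_E (x ^ 2) * rr_G x) * rr_G (x ^ 4) + s * x * ((euler_E (x ^ 2) * rr_H x) * rr_H (x ^ 4))"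
    by (simp add: algebra_simps)
  also have "\<dots> = euler_E (x ^ 8) * (rr_G (x ^ 4) * rr_G (x ^ 16) + s * (x * x ^ 3) * (rr_H (x ^ 4) * rr_H (x ^ 16)))
       + x * (euler_E (x ^ 8) * (rr_G (x ^ 4) * rr_H (- (x ^ 4))) + s * (euler_E (x ^ 8) * (rr_G (- (x ^ 4)) * rr_H (x ^ 4))))"
    unfolding rr_G_dissection[OF x] rr_H_dissection[OF x] by (simp add: algebra_simps)
  also have "x * x ^ 3 = x ^ 4" by (simp add: eval_nat_numeral)
  finally show ?thesis .
qed

text \<open>\<open>rr_GH_product_dissection\<close> at \<open>x^4\<close> and at
  \<open>-x^4\<close>; the two values have sum \<open>2 psi(x^8)\<close> and difference
  \<open>2 x^4 psi(x^40)\<close>.\<close>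

lemma rr_psi_at_4:
  assumes x: "norm x < 1"
  shows "euler_E (x ^ 8) * (rr_G (x ^ 4) * rr_H (- (x ^ 4))) = ramanujan_f (x ^ 8) (x ^ 24) + x ^ 4 * ramanujan_f (x ^ 40) (x ^ 120)"
    and "euler_E (x ^ 8) * (rr_G (- (x ^ 4)) * rr_H (x ^ 4)) = ramanujan_f (x ^ 8) (x ^ 24) - x ^ 4 * ramanujan_f (x ^ 40) (x ^ 120)"
proof -
  have x4: "norm (x ^ 4) < 1" "norm (- (x ^ 4)) < 1" using x norm_power_lt_1[of x 4] by auto
  show "euler_E (x ^ 8) * (rr_G (x ^ 4) * rr_H (- (x ^ 4))) = ramanujan_f (x ^ 8) (x ^ 24) + x ^ 4 * ramanujan_f (x ^ 40) (x ^ 120)"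
    using rr_GH_product_dissection[OF x4(1)] by (simp flip: power_mult)
  show "euler_E (x ^ 8) * (rr_G (- (x ^ 4)) * rr_H (x ^ 4)) = ramanujan_f (x ^ 8) (x ^ 24) - x ^ 4 * ramanujan_f (x ^ 40) (x ^ 120)"
    using rr_GH_product_dissection[OF x4(2)] by (simp flip: power_mult)
qed

text \<open>Both sides satisfy \<open>X(x) = X(x\<^sup>4) + 2 x \<psi>(x\<^sup>8)\<close>, so their difference is invariant under \<open>x \<mapsto> x\<^sup>4\<close>.\<close>

lemma rr_phi:
  assumes x: "norm x < 1"
  shows "ramanujan_f x x = euler_E (x ^ 2) * (rr_G x * rr_G (x ^ 4) + x * (rr_H x * rr_H (x ^ 4)))"
proof -
  define g where "g = (\<lambda>x. euler_E (x ^ 2) * (rr_G x * rr_G (x ^ 4) + x * (rr_H x * rr_H (x ^ 4))) - ramanujan_f x x)"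
  have "g x = 0"
  proof (rule eq_limit_at_0_of_power_invariant[OF _ _ x])
    fix x :: complex assume x: "norm x < 1"
    show "g x = g (x ^ 4)"
      using rr_phi_step[OF x, of 1] phi_dissection[OF x]
      unfolding g_def rr_psi_at_4[OF x] by (simp add: algebra_simps flip: power_mult)
  next
    have "((\<lambda>x. euler_E (x ^ 2) * (rr_G (x ^ 1) * rr_G (x ^ 4) + x ^ 1 * (rr_H (x ^ 1) * rr_H (x ^ 4))) - ramanujan_f (x ^ 1) (x ^ 1))
          \<longlongrightarrow> 1 * (1 * 1 + 0 * (1 * 1)) - 1) (nhds 0)"
      by (intro tendsto_intros tendsto_rr tendsto_phi tendsto_power_nhds_0) auto
    thus "(g \<longlongrightarrow> 0) (nhds 0)" by (simp add: g_def)
  qed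
  thus ?thesis by (simp add: g_def)
qed

text \<open>The argument of \<open>rr_phi\<close> with \<open>s = -1\<close>: the mixed products
  leave \<open>2 x^5 psi(x^40)\<close>, which is also the difference of \<open>phi(x^5)\<close> and
  \<open>phi(x^20)\<close>.\<close>

lemma rr_phi_5:
  assumes x: "norm x < 1"
  shows "ramanujan_f (x ^ 5) (x ^ 5) = euler_E (x ^ 2) * (rr_G x * rr_G (x ^ 4) - x * (rr_H x * rr_H (x ^ 4)))"
proof -
  define g where "g = (\<lambda>x. euler_E (x ^ 2) * (rr_G x * rr_G (x ^ 4) - x * (rr_H x * rr_H (x ^ 4))) - ramanujan_f (x ^ 5) (x ^ 5))"
  have "g x = 0"
  proof (rule eq_limit_at_0_of_power_invariant[OF _ _ x])
    fix x :: complex assume x: "norm x < 1"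
    have "x * x ^ 4 = x ^ 5" by (simp add: eval_nat_numeral)
    moreover have "ramanujan_f (x ^ 5) (x ^ 5) = ramanujan_f (x ^ 20) (x ^ 20) + 2 * x ^ 5 * ramanujan_f (x ^ 40) (x ^ 120)"
      using phi_dissection[OF norm_power_lt_1[OF x, of 5]] by (simp flip: power_mult)
    ultimately show "g x = g (x ^ 4)"
      using rr_phi_step[OF x, of "-1"]
      unfolding g_def rr_psi_at_4[OF x] by (simp add: algebra_simps flip: power_mult)
  next
    have "((\<lambda>x. euler_E (x ^ 2) * (rr_G (x ^ 1) * rr_G (x ^ 4) - x ^ 1 * (rr_H (x ^ 1) * rr_H (x ^ 4))) - ramanujan_f (x ^ 5) (x ^ 5))
          \<longlongrightarrow> 1 * (1 * 1 - 0 * (1 * 1)) - 1) (nhds 0)"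
      by (intro tendsto_intros tendsto_rr tendsto_phi tendsto_power_nhds_0) auto
    thus "(g \<longlongrightarrow> 0) (nhds 0)" by (simp add: g_def)
  qed
  thus ?thesis by (simp add: g_def)
qed

section \<open>Two identities of Rogers\<close>

text \<open>The nonprincipal Dirichlet character modulo 4.\<close>

definition chi4 :: "int \<Rightarrow> complex" where
  "chi4 x = (if x mod 4 = 1 then 1 else if x mod 4 = 3 then -1 else 0)"

text \<open>Completing the square turns theta functions \<open>f(-q^i, -q^j)\<close> into sums of
  this kind: \<open>chi4\<close> discards even \<open>x\<close> and carries the alternating
  sign.\<close>

definition chi_theta :: "int \<Rightarrow> int \<Rightarrow> int \<Rightarrow> complex \<Rightarrow> complex" where
  "chi_theta c m r t = (\<Sum>\<^sub>\<infinity>x\<in>{x. x mod m = r}. chi4 x * t powi (c * x\<^sup>2))"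

lemma chi4_minus: "chi4 (-x) = - chi4 x"
proof -
  have "(-x) mod 4 = 1 \<longleftrightarrow> x mod 4 = 3" "(-x) mod 4 = 3 \<longleftrightarrow> x mod 4 = 1" by presburger+
  thus ?thesis by (simp add: chi4_def)
qed

lemma chi4_even: "even x \<Longrightarrow> chi4 x = 0"
proof -
  assume "even x"
  hence "x mod 4 \<noteq> 1" "x mod 4 \<noteq> 3" by presburger+
  thus ?thesis by (simp add: chi4_def)
qed

lemma has_sum_chi_theta:
  assumes t: "norm t < 1" and c: "c \<ge> 1"
  shows "((\<lambda>x. chi4 x * t powi (c * x\<^sup>2)) has_sum chi_theta c m r t) {x. x mod m = r}"
proof -
  have "(\<lambda>x. chi4 x * t powi (c * x\<^sup>2)) summable_on {x. x mod m = r}"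
  proof (rule summable_on_int_dominated)
    fix x :: int
    have "\<bar>x\<bar> \<le> 1 * x\<^sup>2" using abs_le_square_int[of x] by (simp add: power2_eq_square)
    also have "\<dots> \<le> c * x\<^sup>2" using c by (intro mult_right_mono) auto
    finally have le: "\<bar>x\<bar> \<le> c * x\<^sup>2" .
    have "norm (chi4 x * t powi (c * x\<^sup>2)) \<le> 1 * norm t ^ nat (c * x\<^sup>2)"
      unfolding norm_mult using c by (intro mult_mono) (auto simp: chi4_def power_int_def norm_power)
    also have "\<dots> \<le> norm t ^ nat \<bar>x\<bar>"
      using le t by (simp add: power_decreasing)
    finally show "norm (chi4 x * t powi (c * x\<^sup>2)) \<le> norm t ^ nat \<bar>x\<bar>" .
  qed (use t in auto)
  thus ?thesis unfolding chi_theta_def by simp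
qed

text \<open>Reflection of \<open>x\<close> and oddness of \<open>chi4\<close>. Class 0 therefore
  contributes 0, and only one class of each opposite pair has to be evaluated.\<close>

lemma chi_theta_uminus: "chi_theta c m ((-r) mod m) t = - chi_theta c m (r mod m) t"
proof -
  have "chi_theta c m ((-r) mod m) t = (\<Sum>\<^sub>\<infinity>x\<in>{x. x mod m = r mod m}. - (chi4 x * t powi (c * x\<^sup>2)))"
    unfolding chi_theta_def
  proof (rule infsum_reindex_bij_witness[where i = uminus and j = uminus])
    show "- x \<in> {x. x mod m = r mod m}" if "x \<in> {x. x mod m = (-r) mod m}" for x
      using that by (metis (mono_tags, lifting) mem_Collect_eq minus_minus mod_minus_cong)
    show "- x \<in> {x. x mod m = (-r) mod m}" if "x \<in> {x. x mod m = r mod m}" for x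
      using that by (metis (mono_tags, lifting) mem_Collect_eq mod_minus_cong)
  qed (auto simp: chi4_minus)
  thus ?thesis by (simp add: chi_theta_def infsum_uminus)
qed

text \<open>The odd \<open>x\<close> in the class are \<open>x = 2 m k + s\<close>, and
  \<open>c x^2 = c s^2 + 8 m c (m k^2 + s k) / 2\<close>. Passing from \<open>k\<close> to
  \<open>k + 1\<close> changes \<open>x\<close> by \<open>2 m\<close>, which is 2 modulo 4, whence
  the sign \<open>(-1)^k\<close>.\<close>

lemma chi_theta_eval:
  fixes m s c :: nat
  assumes t: "norm t < 1" and c: "c \<ge> 1" and m: "odd m" and s: "odd s"
    and ij: "i > 0" "j > 0" "m = i + j" "int s = int i - int j"
  shows "chi_theta (int c) (int m) (int (s mod m)) t
           = chi4 (int s) * t ^ (c * s\<^sup>2) * ramanujan_f (- ((t ^ (8 * m * c)) ^ i)) (- ((t ^ (8 * m * c)) ^ j))"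
proof -
  define q where "q = t ^ (8 * m * c)"
  define e where "e = (\<lambda>k::int. (int m * k\<^sup>2 + int s * k) div 2)"
  have q: "norm q < 1" unfolding q_def using t c ij by (intro norm_power_lt_1) auto
  have m0: "m > 0" using ij by auto
  have e: "int m * k\<^sup>2 + int s * k = 2 * e k" for k
    unfolding e_def using m s by simp
  have e_nonneg: "e k \<ge> 0" for k
    using theta_exponent_nonneg[of "int s" "int m" k] ij e[of k] by auto
  have chi: "chi4 (2 * int m * k + int s) = chi4 (int s) * (-1) powi k" for k
  proof -
    obtain a where a: "int m = 2 * a + 1" using m by (metis even_of_nat oddE)
    obtain b where b: "int s = 2 * b + 1" using s by (metis even_of_nat oddE)
    have eq: "(2 * int m * k + int s) mod 4 = (2 * k + int s) mod 4"
    proof -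
      have "2 * int m * k + int s = (2 * k + int s) + 4 * (a * k)" by (simp add: a algebra_simps)
      thus ?thesis by (simp only: mod_mult_self2)
    qed
    show ?thesis
    proof (cases "even k")
      case True
      then obtain l where l: "k = 2 * l" by blast
      have "(2 * k + int s) mod 4 = int s mod 4"
        using mod_mult_self2[of "int s" 4 l] by (simp add: l add.commute)
      thus ?thesis using True eq by (simp add: chi4_def)
    next
      case False
      have "(2 * k + int s) mod 4 = 1 \<longleftrightarrow> int s mod 4 = 3" "(2 * k + int s) mod 4 = 3 \<longleftrightarrow> int s mod 4 = 1"
        using False s by presburger+
      thus ?thesis using False eq by (simp add: chi4_def)
    qed
  qed
  have pw: "t powi (int c * (2 * int m * k + int s)\<^sup>2) = t ^ (c * s\<^sup>2) * q powi e k" for k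
  proof -
    have "int c * (2 * int m * k + int s)\<^sup>2 = int c * (4 * int m * (int m * k\<^sup>2 + int s * k) + (int s)\<^sup>2)"
      by (simp add: power2_eq_square algebra_simps)
    also have "\<dots> = int (c * s\<^sup>2) + int (8 * m * c) * e k"
      unfolding e by (simp add: algebra_simps)
    finally have "t powi (int c * (2 * int m * k + int s)\<^sup>2) = t powi (int (c * s\<^sup>2)) * t powi (int (8 * m * c) * e k)"
      using e_nonneg by (simp only: power_int_add_nonneg of_nat_0_le_iff mult_nonneg_nonneg)
    thus ?thesis
      by (simp only: q_def power_int_of_nat power_int_mult)
  qed
  have "((\<lambda>k. (-1) powi k * q powi e k) has_sum ramanujan_f (- (q ^ i)) (- (q ^ j))) UNIV"
    using has_sum_theta_half[OF q, of "-1" i j "int m" "int s"] ij unfolding e_def by simp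
  hence "((\<lambda>k. chi4 (int s) * t ^ (c * s\<^sup>2) * ((-1) powi k * q powi e k)) has_sum
           chi4 (int s) * t ^ (c * s\<^sup>2) * ramanujan_f (- (q ^ i)) (- (q ^ j))) UNIV"
    by (rule has_sum_cmult_right)
  also have "?this \<longleftrightarrow> ((\<lambda>x. chi4 x * t powi (int c * x\<^sup>2)) has_sum
           chi4 (int s) * t ^ (c * s\<^sup>2) * ramanujan_f (- (q ^ i)) (- (q ^ j))) {x. x mod (2 * int m) = int s mod (2 * int m)}"
  proof (rule has_sum_reindex_bij_witness[where i = "\<lambda>x. (x - int s) div (2 * int m)" and j = "\<lambda>k. 2 * int m * k + int s"])
    show "chi4 (2 * int m * k + int s) * t powi (int c * (2 * int m * k + int s)\<^sup>2)
            = chi4 (int s) * t ^ (c * s\<^sup>2) * ((-1) powi k * q powi e k)" for k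
      unfolding chi pw by (simp only: mult_ac)
  qed (use m0 in \<open>auto simp: mod_eq_dvd_iff\<close>)
  also have "\<dots> \<longleftrightarrow> ((\<lambda>x. chi4 x * t powi (int c * x\<^sup>2)) has_sum
           chi4 (int s) * t ^ (c * s\<^sup>2) * ramanujan_f (- (q ^ i)) (- (q ^ j))) {x. x mod int m = int s mod int m}"
  proof (rule has_sum_cong_neutral)
    \<comment> \<open>As \<open>m\<close> and \<open>s\<close> are odd, a number congruent to
      \<open>s\<close> modulo \<open>m\<close> but not modulo \<open>2 m\<close> is even, and there
      \<open>chi4\<close> vanishes.\<close>
    fix x assume x: "x \<in> {x. x mod int m = int s mod int m} - {x. x mod (2 * int m) = int s mod (2 * int m)}"
    hence "int m dvd x - int s" "\<not> 2 * int m dvd x - int s"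
      by (auto simp: mod_eq_dvd_iff)
    hence "\<not> 2 dvd x - int s"
      using m by (metis coprime_left_2_iff_odd divides_mult even_of_nat)
    hence "even x" using s by simp
    thus "chi4 x * t powi (int c * x\<^sup>2) = 0" by (simp add: chi4_even)
  next
    fix x assume "x \<in> {x. x mod (2 * int m) = int s mod (2 * int m)} - {x. x mod int m = int s mod int m}"
    thus "chi4 x * t powi (int c * x\<^sup>2) = 0"
      by (auto simp: mod_eq_dvd_iff dest: dvd_mult_right)
  qed auto
  finally have "((\<lambda>x. chi4 x * t powi (int c * x\<^sup>2)) has_sum
           chi4 (int s) * t ^ (c * s\<^sup>2) * ramanujan_f (- (q ^ i)) (- (q ^ j))) {x. x mod int m = int (s mod m)}"
    by (simp add: zmod_int)
  from has_sum_unique[OF has_sum_chi_theta[OF t] this] c show ?thesis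
    by (simp add: q_def)
qed

text \<open>The congruence condition describes a disjoint union of products of residue classes, one
  for each class of \<open>y\<close>, with \<open>h\<close> giving the matching class of
  \<open>x\<close>.\<close>

lemma has_sum_chi_theta_pairs:
  assumes t: "norm t < 1" and c: "c \<ge> 1" "d \<ge> 1" and m: "m > 0"
  shows "((\<lambda>(x, y). chi4 x * chi4 y * t powi (c * x\<^sup>2 + d * y\<^sup>2)) has_sum
           (\<Sum>r\<in>{0..<m}. chi_theta c m (h r) t * chi_theta d m r t)) {(x, y). x mod m = h (y mod m)}"
proof -
  have eq: "chi4 x * chi4 y * t powi (c * x\<^sup>2 + d * y\<^sup>2) = (chi4 x * t powi (c * x\<^sup>2)) * (chi4 y * t powi (d * y\<^sup>2))" for x y
    using c by (simp add: power_int_add_nonneg)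
  have "((\<lambda>(x, y). (chi4 x * t powi (c * x\<^sup>2)) * (chi4 y * t powi (d * y\<^sup>2))) has_sum
           (\<Sum>r\<in>{0..<m}. chi_theta c m (h r) t * chi_theta d m r t)) (\<Union>r\<in>{0..<m}. {x. x mod m = h r} \<times> {y. y mod m = r})"
    by (rule sum_has_sum) (auto intro!: has_sum_times has_sum_chi_theta t c)
  also have "(\<Union>r\<in>{0..<m}. {x. x mod m = h r} \<times> {y. y mod m = r}) = {(x, y). x mod m = h (y mod m)}"
    using m by auto
  finally show ?thesis by (simp only: eq)
qed

lemma chi_theta_zero: "chi_theta c m 0 t = 0"
  using chi_theta_uminus[of c m 0 t] by simp

text \<open>Rogers' method: \<open>5(2u\<^sup>2 + 7v\<^sup>2) = 3(x\<^sup>2 + 14y\<^sup>2)\<close> for \<open>u = v + 3k\<close>, \<open>x = 4k - v\<close>, \<open>y = v + k\<close>.  The classes in which 3 or 5 divides both variables contribute nothing because \<open>chi4\<close> is odd.\<close>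

lemma rogers_lattice_1:
  assumes t: "norm t < 1"
  shows "chi_theta 10 3 1 t * chi_theta 35 3 1 t
       = chi_theta 3 5 1 t * chi_theta 42 5 1 t + chi_theta 3 5 3 t * chi_theta 42 5 3 t"
proof -
  define F where "F = (\<lambda>(u, v). chi4 u * chi4 v * t powi (10 * u\<^sup>2 + 35 * v\<^sup>2))"
  define G where "G = (\<lambda>(x, y). chi4 x * chi4 y * t powi (3 * x\<^sup>2 + 42 * y\<^sup>2))"
  let ?S = "\<Sum>r\<in>{0..<3}. chi_theta 10 3 r t * chi_theta 35 3 r t"
  let ?T = "\<Sum>r\<in>{0..<5}. chi_theta 3 5 ((-r) mod 5) t * chi_theta 42 5 r t"
  have 1: "(F has_sum ?S) {(u, v). u mod 3 = v mod 3}"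
    using has_sum_chi_theta_pairs[OF t, of 10 35 3 "\<lambda>r. r"] by (simp add: F_def)
  have 2: "(G has_sum ?T) {(x, y). x mod 5 = (- y) mod 5}"
    using has_sum_chi_theta_pairs[OF t, of 3 42 5 "\<lambda>r. (-r) mod 5"] by (simp add: G_def mod_minus_eq)
  \<comment> \<open>If \<open>v\<close> is even, or \<open>v\<close> and \<open>k\<close> are both
    odd, both sides are 0. Otherwise \<open>k\<close> is even, so \<open>3 k\<close> and
    \<open>k\<close> agree modulo 4; the sign comes from \<open>4 k - v\<close> being
    \<open>-v\<close> modulo 4.\<close>
  have chi: "chi4 (v + 3 * k) * chi4 v = - (chi4 (4 * k - v) * chi4 (v + k))" for v k
  proof -
    have "chi4 (4 * k - v) = - chi4 v"
    proof -
      have "(4 * k - v) mod 4 = (- v) mod 4" by presburger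
      thus ?thesis unfolding chi4_minus[of v, symmetric] by (simp add: chi4_def)
    qed
    moreover have "chi4 v * chi4 (v + 3 * k) = chi4 v * chi4 (v + k)"
    proof (cases "even v \<or> odd k")
      case True
      thus ?thesis by (cases "even v") (simp_all add: chi4_even)
    next
      case False
      hence "(v + 3 * k) mod 4 = (v + k) mod 4" by presburger
      thus ?thesis by (simp add: chi4_def)
    qed
    ultimately show ?thesis by (simp add: mult_ac)
  qed
  have "((\<lambda>(v, k). F (v + 3 * k, v)) has_sum ?S) UNIV \<longleftrightarrow> (F has_sum ?S) {(u, v). u mod 3 = v mod 3}"
    by (rule has_sum_reindex_bij_witness[where i = "\<lambda>(u, v). (v, (u - v) div 3)" and j = "\<lambda>(v, k). (v + 3 * k, v)"])
       (clarsimp, presburger?)+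
  hence "((\<lambda>(v, k). F (v + 3 * k, v)) has_sum ?S) UNIV" using 1 by simp
  also have "(\<lambda>(v, k). F (v + 3 * k, v)) = (\<lambda>(v, k). - G (4 * k - v, v + k))"
  proof -
    have "F (v + 3 * k, v) = - G (4 * k - v, v + k)" for v k
    proof -
    have "10 * (v + 3 * k)\<^sup>2 + 35 * v\<^sup>2 = 3 * (4 * k - v)\<^sup>2 + 42 * (v + k)\<^sup>2"
      by (simp add: power2_eq_square algebra_simps)
    thus ?thesis using chi[of v k] by (simp add: F_def G_def)
    qed
    thus ?thesis by simp
  qed
  also have "((\<lambda>(v, k). - G (4 * k - v, v + k)) has_sum ?S) UNIV
      \<longleftrightarrow> ((\<lambda>z. - G z) has_sum ?S) {(x, y). x mod 5 = (- y) mod 5}"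
  proof (rule has_sum_reindex_bij_witness[where j = "\<lambda>(v, k). (4 * k - v, v + k)" and i = "\<lambda>(x, y). (y - (x + y) div 5, (x + y) div 5)"], goal_cases)
    case (3 z)
    obtain x y where z: "z = (x, y)" by force
    have "5 * ((x + y) div 5) = x + y" using 3 by (simp add: z mod_eq_dvd_iff)
    thus ?case by (simp add: z)
  qed (auto simp: mod_eq_dvd_iff)
  finally have "((\<lambda>z. - G z) has_sum ?S) {(x, y). x mod 5 = (- y) mod 5}" .
  moreover have "((\<lambda>z. - G z) has_sum - ?T) {(x, y). x mod 5 = (- y) mod 5}"
    using 2 by (rule has_sum_uminusI)
  ultimately have ST: "?S = - ?T" by (rule has_sum_unique)
  have r3: "{0..<3} = {0, 1, 2 :: int}" and r5: "{0..<5} = {0, 1, 2, 3, 4 :: int}" by auto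
  \<comment> \<open>Opposite classes agree up to sign, so the sums over 3 and 5 classes reduce to
    twice one product and twice two products.\<close>
  have neg: "chi_theta c 3 2 t = - chi_theta c 3 1 t" "chi_theta c 5 4 t = - chi_theta c 5 1 t"
    "chi_theta c 5 2 t = - chi_theta c 5 3 t" for c
    using chi_theta_uminus[of c 3 1 t] chi_theta_uminus[of c 5 1 t] chi_theta_uminus[of c 5 3 t] by simp_all
  from ST show ?thesis
    by (simp add: r3 r5 neg chi_theta_zero) algebra
qed

text \<open>The companion \<open>5 (u^2 + 14 v^2) = 3 (2 x^2 + 7 y^2)\<close> for
  \<open>u = 3k - v\<close>, \<open>x = 2k - 3v\<close>, \<open>y = v + k\<close>. Here
  \<open>x\<close> is \<open>2 y\<close> modulo 5, which mixes the classes 1 and 3 and produces the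
  minus sign.\<close>

lemma rogers_lattice_2:
  assumes t: "norm t < 1"
  shows "chi_theta 5 3 1 t * chi_theta 70 3 1 t
       = chi_theta 6 5 1 t * chi_theta 21 5 3 t - chi_theta 6 5 3 t * chi_theta 21 5 1 t"
proof -
  define F where "F = (\<lambda>(u, v). chi4 u * chi4 v * t powi (5 * u\<^sup>2 + 70 * v\<^sup>2))"
  define G where "G = (\<lambda>(x, y). chi4 x * chi4 y * t powi (6 * x\<^sup>2 + 21 * y\<^sup>2))"
  let ?S = "\<Sum>r\<in>{0..<3}. chi_theta 5 3 ((-r) mod 3) t * chi_theta 70 3 r t"
  let ?T = "\<Sum>r\<in>{0..<5}. chi_theta 6 5 ((2 * r) mod 5) t * chi_theta 21 5 r t"
  have 1: "(F has_sum ?S) {(u, v). u mod 3 = (- v) mod 3}"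
    using has_sum_chi_theta_pairs[OF t, of 5 70 3 "\<lambda>r. (-r) mod 3"] by (simp add: F_def mod_minus_eq)
  have 2: "(G has_sum ?T) {(x, y). x mod 5 = (2 * y) mod 5}"
    using has_sum_chi_theta_pairs[OF t, of 6 21 5 "\<lambda>r. (2 * r) mod 5"] by (simp add: G_def mod_mult_right_eq)
  have chi: "chi4 (3 * k - v) * chi4 v = - (chi4 (2 * k - 3 * v) * chi4 (v + k))" for v k
  proof (cases "even v \<or> odd k")
    case True
    thus ?thesis by (cases "even v") (simp_all add: chi4_even)
  next
    case False
    hence "(2 * k - 3 * v) mod 4 = v mod 4" "(3 * k - v) mod 4 = (- (v + k)) mod 4" by presburger+
    hence "chi4 (2 * k - 3 * v) = chi4 v" "chi4 (3 * k - v) = - chi4 (v + k)"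
      unfolding chi4_minus[symmetric] by (simp_all add: chi4_def)
    thus ?thesis by (simp add: mult_ac)
  qed
  have "((\<lambda>(v, k). F (3 * k - v, v)) has_sum ?S) UNIV \<longleftrightarrow> (F has_sum ?S) {(u, v). u mod 3 = (- v) mod 3}"
    by (rule has_sum_reindex_bij_witness[where i = "\<lambda>(u, v). (v, (u + v) div 3)" and j = "\<lambda>(v, k). (3 * k - v, v)"])
       (clarsimp, presburger?)+
  hence "((\<lambda>(v, k). F (3 * k - v, v)) has_sum ?S) UNIV" using 1 by simp
  also have "(\<lambda>(v, k). F (3 * k - v, v)) = (\<lambda>(v, k). - G (2 * k - 3 * v, v + k))"
  proof -
    have "F (3 * k - v, v) = - G (2 * k - 3 * v, v + k)" for v k
    proof -
    have "5 * (3 * k - v)\<^sup>2 + 70 * v\<^sup>2 = 6 * (2 * k - 3 * v)\<^sup>2 + 21 * (v + k)\<^sup>2"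
      by (simp add: power2_eq_square algebra_simps)
    thus ?thesis using chi[of k v] by (simp add: F_def G_def)
    qed
    thus ?thesis by simp
  qed
  also have "((\<lambda>(v, k). - G (2 * k - 3 * v, v + k)) has_sum ?S) UNIV
      \<longleftrightarrow> ((\<lambda>z. - G z) has_sum ?S) {(x, y). x mod 5 = (2 * y) mod 5}"
  proof (rule has_sum_reindex_bij_witness[where j = "\<lambda>(v, k). (2 * k - 3 * v, v + k)"
          and i = "\<lambda>(x, y). ((2 * y - x) div 5, y - (2 * y - x) div 5)"], goal_cases)
    case (3 z)
    obtain x y where z: "z = (x, y)" by force
    have "5 dvd 2 * y - x" using 3 by (simp add: z mod_eq_dvd_iff dvd_diff_commute)
    hence "5 * ((2 * y - x) div 5) = 2 * y - x" by simp
    thus ?case by (simp add: z)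
  qed (auto simp: mod_eq_dvd_iff)
  finally have "((\<lambda>z. - G z) has_sum ?S) {(x, y). x mod 5 = (2 * y) mod 5}" .
  moreover have "((\<lambda>z. - G z) has_sum - ?T) {(x, y). x mod 5 = (2 * y) mod 5}"
    using 2 by (rule has_sum_uminusI)
  ultimately have ST: "?S = - ?T" by (rule has_sum_unique)
  have r3: "{0..<3} = {0, 1, 2 :: int}" and r5: "{0..<5} = {0, 1, 2, 3, 4 :: int}" by auto
  have neg: "chi_theta c 3 2 t = - chi_theta c 3 1 t" "chi_theta c 5 4 t = - chi_theta c 5 1 t"
    "chi_theta c 5 2 t = - chi_theta c 5 3 t" for c
    using chi_theta_uminus[of c 3 1 t] chi_theta_uminus[of c 5 1 t] chi_theta_uminus[of c 5 3 t] by simp_all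
  from ST show ?thesis
    by (simp add: r3 r5 neg chi_theta_zero) algebra
qed

text \<open>In \<open>chi_theta_eval\<close> the choice \<open>(i, j) = (2, 1)\<close> gives the
  pentagonal series; below, \<open>(3, 2)\<close> and \<open>(4, 1)\<close> give the series for
  \<open>rr_G\<close> and \<open>rr_H\<close>.\<close>

lemma chi_theta_3_1:
  assumes t: "norm t < 1" and c: "c \<ge> 1"
  shows "chi_theta (int c) 3 1 t = t ^ c * euler_E (t ^ (24 * c))"
proof -
  define q where "q = t ^ (8 * 3 * c)"
  have q: "norm q < 1" unfolding q_def using t c by (intro norm_power_lt_1) auto
  have "chi_theta (int c) (int 3) (int (1 mod 3)) t
          = chi4 (int 1) * t ^ (c * 1\<^sup>2) * ramanujan_f (- (q ^ 2)) (- (q ^ 1))"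
    unfolding q_def by (rule chi_theta_eval[OF t c]) simp_all
  also have "ramanujan_f (- (q ^ 2)) (- (q ^ 1)) = ramanujan_f (- (q ^ 1)) (- (q ^ 2))"
    by (rule ramanujan_f_commute)
  also have "\<dots> = euler_E q"
    using euler_E_theta[OF q] by simp
  finally show ?thesis
    by (simp add: chi4_def q_def mult.commute)
qed

lemma chi_theta_5_1:
  assumes t: "norm t < 1" and c: "c \<ge> 1"
  shows "chi_theta (int c) 5 1 t = t ^ c * (euler_E (t ^ (40 * c)) * rr_G (t ^ (40 * c)))"
proof -
  define q where "q = t ^ (8 * 5 * c)"
  have q: "norm q < 1" unfolding q_def using t c by (intro norm_power_lt_1) auto
  have "chi_theta (int c) (int 5) (int (1 mod 5)) t
          = chi4 (int 1) * t ^ (c * 1\<^sup>2) * ramanujan_f (- (q ^ 3)) (- (q ^ 2))"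
    unfolding q_def by (rule chi_theta_eval[OF t c]) simp_all
  also have "ramanujan_f (- (q ^ 3)) (- (q ^ 2)) = ramanujan_f (- (q ^ 2)) (- (q ^ 3))"
    by (rule ramanujan_f_commute)
  also have "\<dots> = euler_E q * rr_G q"
    using ramanujan_f_rr(1)[OF q] by simp
  finally show ?thesis
    by (simp add: chi4_def q_def mult.commute)
qed

lemma chi_theta_5_3:
  assumes t: "norm t < 1" and c: "c \<ge> 1"
  shows "chi_theta (int c) 5 3 t = - (t ^ (9 * c) * (euler_E (t ^ (40 * c)) * rr_H (t ^ (40 * c))))"
proof -
  define q where "q = t ^ (8 * 5 * c)"
  have q: "norm q < 1" unfolding q_def using t c by (intro norm_power_lt_1) auto
  have "chi_theta (int c) (int 5) (int (3 mod 5)) t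
          = chi4 (int 3) * t ^ (c * 3\<^sup>2) * ramanujan_f (- (q ^ 4)) (- (q ^ 1))"
    unfolding q_def by (rule chi_theta_eval[OF t c]) simp_all
  also have "ramanujan_f (- (q ^ 4)) (- (q ^ 1)) = ramanujan_f (- (q ^ 1)) (- (q ^ 4))"
    by (rule ramanujan_f_commute)
  also have "\<dots> = euler_E q * rr_H q"
    using ramanujan_f_rr(2)[OF q] by simp
  finally show ?thesis
    by (simp add: chi4_def q_def mult.commute)
qed

lemma exists_root_120:
  fixes q :: complex
  assumes "norm q < 1"
  obtains t where "q = t ^ 120" "norm t < 1"
proof -
  define t where "t = (if q = 0 then 0 else exp (ln q / 120))"
  have q: "q = t ^ 120"
    by (simp add: t_def flip: exp_of_nat_mult)
  moreover have "norm t < 1"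
  proof (rule ccontr)
    assume "\<not> norm t < 1"
    hence "1 \<le> norm t ^ 120" by (intro one_le_power) auto
    thus False using assms by (simp add: q norm_power)
  qed
  ultimately show ?thesis using that by blast
qed

text \<open>With \<open>q = t\<^sup>1\<^sup>2\<^sup>0\<close> all the exponents \<open>u\<^sup>2/24\<close> and \<open>x\<^sup>2/40\<close> become integral.\<close>

lemma rogers_identity_1:
  assumes q: "norm q < 1"
  shows "euler_E q * euler_E (q ^ 14) * (rr_G q * rr_G (q ^ 14) + q ^ 3 * (rr_H q * rr_H (q ^ 14)))
       = euler_E (q ^ 2) * euler_E (q ^ 7)"
\<comment> \<open>The point \<open>q = 0\<close> is treated separately because a power of
  \<open>t\<close> has to be cancelled.\<close>
proof (cases "q = 0")
  case True
  thus ?thesis by (simp add: rr_G_def euler_E_eq_qpoch qpoch_def)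
next
  case False
  obtain t where qt: "q = t ^ 120" and t: "norm t < 1" using exists_root_120[OF q] .
  have t0: "t \<noteq> 0" using False qt by auto
  \<comment> \<open>The common leading exponent is \<open>45 = 10 + 35 = 3 + 42\<close>; the other
    product starts at \<open>27 + 378 = 45 + 360\<close>, which gives \<open>q^3\<close>.\<close>
  have "t ^ 45 * (euler_E (q ^ 2) * euler_E (q ^ 7))
      = t ^ 45 * (euler_E q * euler_E (q ^ 14) * (rr_G q * rr_G (q ^ 14) + q ^ 3 * (rr_H q * rr_H (q ^ 14))))"
    using rogers_lattice_1[OF t] chi_theta_3_1[OF t, of 10] chi_theta_3_1[OF t, of 35]
      chi_theta_5_1[OF t, of 3] chi_theta_5_1[OF t, of 42] chi_theta_5_3[OF t, of 3] chi_theta_5_3[OF t, of 42]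
    unfolding qt by (simp add: algebra_simps flip: power_mult power_add)
  thus ?thesis using t0 by simp
qed

text \<open>From \<open>rogers_lattice_2\<close> in the same way. The value is the reciprocal of
  that in \<open>rogers_identity_1\<close>, which the comparison of \<open>rr_A\<close> and
  \<open>rr_B\<close> relies on.\<close>

lemma rogers_identity_2:
  assumes q: "norm q < 1"
  shows "euler_E (q ^ 2) * euler_E (q ^ 7) * (rr_G (q ^ 7) * rr_H (q ^ 2) - q * (rr_G (q ^ 2) * rr_H (q ^ 7)))
       = euler_E q * euler_E (q ^ 14)"
proof (cases "q = 0")
  case True
  thus ?thesis by (simp add: rr_G_def rr_H_def euler_E_eq_qpoch qpoch_def)
next
  case False
  obtain t where qt: "q = t ^ 120" and t: "norm t < 1" using exists_root_120[OF q] .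
  have t0: "t \<noteq> 0" using False qt by auto
  \<comment> \<open>Here \<open>75 = 5 + 70 = 54 + 21\<close>, and \<open>6 + 189 = 75 + 120\<close>
    gives the factor \<open>q\<close>.\<close>
  have "t ^ 75 * (euler_E q * euler_E (q ^ 14))
      = t ^ 75 * (euler_E (q ^ 2) * euler_E (q ^ 7) * (rr_G (q ^ 7) * rr_H (q ^ 2) - q * (rr_G (q ^ 2) * rr_H (q ^ 7))))"
    using rogers_lattice_2[OF t] chi_theta_3_1[OF t, of 5] chi_theta_3_1[OF t, of 70]
      chi_theta_5_1[OF t, of 6] chi_theta_5_1[OF t, of 21] chi_theta_5_3[OF t, of 6] chi_theta_5_3[OF t, of 21]
    unfolding qt by (simp add: algebra_simps flip: power_mult power_add)
  thus ?thesis using t0 by simp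
qed

section \<open>Theta series of binary forms\<close>

text \<open>A class \<open>B\<close> of the lattice is parametrized by \<open>J\<close> with inverse
  \<open>I\<close>. In the new coordinates the form has no mixed term, so the class contributes a
  monomial times two one-variable theta functions.\<close>

lemma has_sum_quadratic_piece:
  fixes q :: complex and A C l l' :: int and e :: "int \<times> int \<Rightarrow> int"
  assumes q: "norm q < 1"
    and ij: "i > 0" "j > 0" "int i = A + l" "int j = A - l"
    and ij': "i' > 0" "j' > 0" "int i' = C + l'" "int j' = C - l'"
    and e: "\<And>a b. e (J (a, b)) = int c + ((A * a\<^sup>2 + l * a) + (C * b\<^sup>2 + l' * b))"
    and B: "\<And>a b. J (a, b) \<in> B" "\<And>a b. I (J (a, b)) = (a, b)" "\<And>n m. (n, m) \<in> B \<Longrightarrow> J (I (n, m)) = (n, m)"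
  shows "((\<lambda>z. q powi e z) has_sum q ^ c * (ramanujan_f (q ^ i) (q ^ j) * ramanujan_f (q ^ i') (q ^ j'))) B"
proof -
  have "((\<lambda>(a, b). q powi (A * a\<^sup>2 + l * a) * q powi (C * b\<^sup>2 + l' * b)) has_sum
           ramanujan_f (q ^ i) (q ^ j) * ramanujan_f (q ^ i') (q ^ j')) (UNIV \<times> UNIV)"
    by (rule has_sum_times; rule has_sum_theta) (use q ij ij' in auto)
  from has_sum_cmult_right[OF this, of "q ^ c"]
  have "((\<lambda>z. q ^ c * (case z of (a, b) \<Rightarrow> q powi (A * a\<^sup>2 + l * a) * q powi (C * b\<^sup>2 + l' * b))) has_sum
           q ^ c * (ramanujan_f (q ^ i) (q ^ j) * ramanujan_f (q ^ i') (q ^ j'))) UNIV"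
    by simp
  also have "?this \<longleftrightarrow> ((\<lambda>z. q powi e z) has_sum q ^ c * (ramanujan_f (q ^ i) (q ^ j) * ramanujan_f (q ^ i') (q ^ j'))) B"
  proof (rule has_sum_reindex_bij_witness[where i = I and j = J])
    fix z :: "int \<times> int"
    obtain a b where z: "z = (a, b)" by force
    have "\<bar>l\<bar> \<le> A" "\<bar>l'\<bar> \<le> C" using ij ij' by auto
    hence nn: "A * a\<^sup>2 + l * a \<ge> 0" "C * b\<^sup>2 + l' * b \<ge> 0" by (simp_all only: theta_exponent_nonneg)
    have "q powi e (J z) = q ^ c * (q powi (A * a\<^sup>2 + l * a) * q powi (C * b\<^sup>2 + l' * b))"
      unfolding z e using nn by (simp only: power_int_add_nonneg add_nonneg_nonneg of_nat_0_le_iff power_int_of_nat)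
    thus "q powi e (J z) = q ^ c * (case z of (a, b) \<Rightarrow> q powi (A * a\<^sup>2 + l * a) * q powi (C * b\<^sup>2 + l' * b))"
      by (simp only: z case_prod_conv)
  qed (use B in auto)
  finally show ?thesis .
qed

lemma qf_theta_diagonal:
  assumes q: "norm q < 1" and ac: "a > 0" "c > 0"
  shows "qf_theta (int a) 0 (int c) q = ramanujan_f (q ^ a) (q ^ a) * ramanujan_f (q ^ c) (q ^ c)"
proof -
  have "((\<lambda>z. q powi (case z of (n, m) \<Rightarrow> int a * n\<^sup>2 + 0 * n * m + int c * m\<^sup>2)) has_sum
          q ^ 0 * (ramanujan_f (q ^ a) (q ^ a) * ramanujan_f (q ^ c) (q ^ c))) UNIV"
    by (rule has_sum_quadratic_piece[where A = "int a" and C = "int c" and l = 0 and l' = 0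
          and I = "\<lambda>z. z" and J = "\<lambda>z. z"]) (use q ac in auto)
  thus ?thesis
    unfolding qf_theta_def by (intro infsumI) (simp add: case_prod_unfold)
qed

text \<open>The vectors \<open>(1, 0)\<close> and \<open>(-2, 5)\<close> are orthogonal for the
  form, with values 5 and 280, and span a sublattice of index 5. Its cosets are the classes of
  \<open>m\<close> modulo 5; opposite cosets contribute equally, hence the factors 2.\<close>

lemma qf_theta_5_4_12:
  assumes q: "norm q < 1"
  shows "qf_theta 5 4 12 q = ramanujan_f (q ^ 5) (q ^ 5) * ramanujan_f (q ^ 280) (q ^ 280)
     + 2 * q ^ 12 * (ramanujan_f q (q ^ 9) * ramanujan_f (q ^ 168) (q ^ 392))
     + 2 * q ^ 45 * (ramanujan_f (q ^ 3) (q ^ 7) * ramanujan_f (q ^ 56) (q ^ 504))"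
proof -
  define e :: "int \<times> int \<Rightarrow> int" where "e = (\<lambda>(n, m). 5 * n\<^sup>2 + 4 * n * m + 12 * m\<^sup>2)"
  \<comment> \<open>In coset \<open>r\<close> the linear coefficient of \<open>n\<close> is
    \<open>4 r - 10 d\<close>; the shift \<open>d\<close> is chosen below to make it smaller than 5
    in absolute value.\<close>
  define J :: "int \<Rightarrow> int \<Rightarrow> int \<times> int \<Rightarrow> int \<times> int" where "J = (\<lambda>r d (n, k). (n - 2 * k - d, 5 * k + r))"
  define I :: "int \<Rightarrow> int \<Rightarrow> int \<times> int \<Rightarrow> int \<times> int" where "I = (\<lambda>r d (n, m). (n + 2 * ((m - r) div 5) + d, (m - r) div 5))"
  define B :: "int \<Rightarrow> (int \<times> int) set" where "B = (\<lambda>r. {(n, m). m mod 5 = r mod 5})"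
  define T where "T = (\<lambda>c i j i' j'. q ^ c * (ramanujan_f (q ^ i) (q ^ j) * ramanujan_f (q ^ i') (q ^ j')))"
  have B1: "J r d (n, k) \<in> B r" for r d n k by (simp add: J_def B_def)
  have B2: "I r d (J r d (n, k)) = (n, k)" for r d n k by (simp add: J_def I_def)
  have B3: "J r d (I r d (n, m)) = (n, m)" if "(n, m) \<in> B r" for r d n m
    using that by (simp add: J_def I_def B_def mod_eq_dvd_iff)
  have piece: "((\<lambda>z. q powi e z) has_sum T c i j i' j') (B r)"
    if "i > 0" "j > 0" "int i = 5 + l" "int j = 5 - l" "i' > 0" "j' > 0" "int i' = 280 + l'" "int j' = 280 - l'"
      and "\<And>n k. e (J r d (n, k)) = int c + ((5 * n\<^sup>2 + l * n) + (280 * k\<^sup>2 + l' * k))" for r d c i j i' j' l l'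
    unfolding T_def by (rule has_sum_quadratic_piece[where J = "J r d" and I = "I r d"]) (use that q B1 B2 B3 in auto)
  define s where "s = (\<lambda>r::int. if r = 0 then T 0 5 5 280 280 else if r = 1 then T 12 9 1 392 168
      else if r = -1 then T 12 1 9 168 392 else if r = 2 then T 45 3 7 504 56 else T 45 7 3 56 504)"
  have "((\<lambda>z. q powi e z) has_sum (\<Sum>r\<in>{-2, -1, 0, 1, 2}. s r)) (\<Union>r\<in>{-2, -1, 0, 1, 2}. B r)"
  proof (rule sum_has_sum)
    fix r :: int assume "r \<in> {-2, -1, 0, 1, 2}"
    then consider "r = -2" | "r = -1" | "r = 0" | "r = 1" | "r = 2" by auto
    thus "((\<lambda>z. q powi e z) has_sum s r) (B r)"
    proof cases
      case 1
      thus ?thesis unfolding s_def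
        using piece[of 7 3 2 56 504 "-224" "-2" "-1" 45] by (simp add: e_def J_def power2_eq_square algebra_simps)
    next
      case 2
      thus ?thesis unfolding s_def
        using piece[of 1 9 "-4" 168 392 "-112" "-1" 0 12] by (simp add: e_def J_def power2_eq_square algebra_simps)
    next
      case 3
      thus ?thesis unfolding s_def
        using piece[of 5 5 0 280 280 0 0 0 0] by (simp add: e_def J_def power2_eq_square algebra_simps)
    next
      case 4
      thus ?thesis unfolding s_def
        using piece[of 9 1 4 392 168 112 1 0 12] by (simp add: e_def J_def power2_eq_square algebra_simps)
    next
      case 5
      thus ?thesis unfolding s_def
        using piece[of 3 7 "-2" 504 56 224 2 1 45] by (simp add: e_def J_def power2_eq_square algebra_simps)
    qed
  qed (auto simp: B_def)
  moreover have "(\<Union>r\<in>{-2, -1, 0, 1, 2}. B r) = UNIV"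
  proof -
    have "m mod 5 \<in> {0..<5}" for m :: int by simp
    also have "{0..<5} = {0, 1, 2, 3, 4 :: int}" by auto
    finally show ?thesis by (auto simp: B_def)
  qed
  ultimately have "((\<lambda>z. q powi e z) has_sum (\<Sum>r\<in>{-2, -1, 0, 1, 2}. s r)) UNIV" by simp
  hence "qf_theta 5 4 12 q = (\<Sum>r\<in>{-2, -1, 0, 1, 2}. s r)"
    unfolding qf_theta_def by (intro infsumI) (simp add: case_prod_unfold e_def)
  also have "\<dots> = T 0 5 5 280 280 + 2 * T 12 1 9 168 392 + 2 * T 45 3 7 56 504"
    using ramanujan_f_commute[of "q ^ 9" q] ramanujan_f_commute[of "q ^ 7" "q ^ 3"]
      ramanujan_f_commute[of "q ^ 392" "q ^ 168"] ramanujan_f_commute[of "q ^ 504" "q ^ 56"]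
    by (simp add: s_def T_def)
  finally show ?thesis by (simp add: T_def)
qed

text \<open>Here \<open>(2, 1)\<close> and \<open>(-3, 1)\<close> are orthogonal, with values 35 and
  40, and span a sublattice of index 5 whose cosets are distinguished by \<open>n + 3 m\<close>
  modulo 5.\<close>

lemma qf_theta_3_2_19:
  assumes q: "norm q < 1"
  shows "qf_theta 3 2 19 q = ramanujan_f (q ^ 35) (q ^ 35) * ramanujan_f (q ^ 40) (q ^ 40)
     + 2 * q ^ 3 * (ramanujan_f (q ^ 21) (q ^ 49) * ramanujan_f (q ^ 24) (q ^ 56))
     + 2 * q ^ 12 * (ramanujan_f (q ^ 7) (q ^ 63) * ramanujan_f (q ^ 8) (q ^ 72))"
proof -
  define e :: "int \<times> int \<Rightarrow> int" where "e = (\<lambda>(n, m). 3 * n\<^sup>2 + 2 * n * m + 19 * m\<^sup>2)"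
  define J :: "int \<Rightarrow> int \<times> int \<Rightarrow> int \<times> int" where "J = (\<lambda>r (a, b). (2 * a - 3 * b + r, a + b))"
  define I :: "int \<Rightarrow> int \<times> int \<Rightarrow> int \<times> int" where "I = (\<lambda>r (n, m). ((n + 3 * m - r) div 5, m - (n + 3 * m - r) div 5))"
  define B :: "int \<Rightarrow> (int \<times> int) set" where "B = (\<lambda>r. {(n, m). (n + 3 * m) mod 5 = r mod 5})"
  define T where "T = (\<lambda>c i j i' j'. q ^ c * (ramanujan_f (q ^ i) (q ^ j) * ramanujan_f (q ^ i') (q ^ j')))"
  have B1: "J r (a, b) \<in> B r" for r a b by (simp add: J_def B_def mod_eq_dvd_iff)
  have B2: "I r (J r (a, b)) = (a, b)" for r a b by (simp add: J_def I_def)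
  have B3: "J r (I r (n, m)) = (n, m)" if "(n, m) \<in> B r" for r n m
  proof -
    have "5 * ((n + 3 * m - r) div 5) = n + 3 * m - r"
      using that by (simp add: B_def mod_eq_dvd_iff)
    thus ?thesis by (simp add: J_def I_def)
  qed
  have piece: "((\<lambda>z. q powi e z) has_sum T c i j i' j') (B r)"
    if "i > 0" "j > 0" "int i = 35 + l" "int j = 35 - l" "i' > 0" "j' > 0" "int i' = 40 + l'" "int j' = 40 - l'"
      and "\<And>a b. e (J r (a, b)) = int c + ((35 * a\<^sup>2 + l * a) + (40 * b\<^sup>2 + l' * b))" for r c i j i' j' l l'
    unfolding T_def by (rule has_sum_quadratic_piece[where J = "J r" and I = "I r"]) (use that q B1 B2 B3 in auto)
  define s where "s = (\<lambda>r::int. if r = 0 then T 0 35 35 40 40 else if r = 1 then T 3 49 21 24 56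
      else if r = -1 then T 3 21 49 56 24 else if r = 2 then T 12 63 7 8 72 else T 12 7 63 72 8)"
  have "((\<lambda>z. q powi e z) has_sum (\<Sum>r\<in>{-2, -1, 0, 1, 2}. s r)) (\<Union>r\<in>{-2, -1, 0, 1, 2}. B r)"
  proof (rule sum_has_sum)
    fix r :: int assume "r \<in> {-2, -1, 0, 1, 2}"
    then consider "r = -2" | "r = -1" | "r = 0" | "r = 1" | "r = 2" by auto
    thus "((\<lambda>z. q powi e z) has_sum s r) (B r)"
    proof cases
      case 1
      thus ?thesis unfolding s_def
        using piece[of 7 63 "-28" 72 8 "32" "-2" 12] by (simp add: e_def J_def power2_eq_square algebra_simps)
    next
      case 2
      thus ?thesis unfolding s_def
        using piece[of 21 49 "-14" 56 24 16 "-1" 3] by (simp add: e_def J_def power2_eq_square algebra_simps)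
    next
      case 3
      thus ?thesis unfolding s_def
        using piece[of 35 35 0 40 40 0 0 0] by (simp add: e_def J_def power2_eq_square algebra_simps)
    next
      case 4
      thus ?thesis unfolding s_def
        using piece[of 49 21 14 24 56 "-16" 1 3] by (simp add: e_def J_def power2_eq_square algebra_simps)
    next
      case 5
      thus ?thesis unfolding s_def
        using piece[of 63 7 28 8 72 "-32" 2 12] by (simp add: e_def J_def power2_eq_square algebra_simps)
    qed
  qed (auto simp: B_def)
  moreover have "(\<Union>r\<in>{-2, -1, 0, 1, 2}. B r) = UNIV"
  proof -
    have "k mod 5 \<in> {0..<5}" for k :: int by simp
    also have "{0..<5} = {0, 1, 2, 3, 4 :: int}" by auto
    finally show ?thesis by (auto simp: B_def)
  qed
  ultimately have "((\<lambda>z. q powi e z) has_sum (\<Sum>r\<in>{-2, -1, 0, 1, 2}. s r)) UNIV" by simp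
  hence "qf_theta 3 2 19 q = (\<Sum>r\<in>{-2, -1, 0, 1, 2}. s r)"
    unfolding qf_theta_def by (intro infsumI) (simp add: case_prod_unfold e_def)
  also have "\<dots> = T 0 35 35 40 40 + 2 * T 3 21 49 24 56 + 2 * T 12 7 63 8 72"
    using ramanujan_f_commute[of "q ^ 49" "q ^ 21"] ramanujan_f_commute[of "q ^ 56" "q ^ 24"]
      ramanujan_f_commute[of "q ^ 63" "q ^ 7"] ramanujan_f_commute[of "q ^ 72" "q ^ 8"]
    by (simp add: s_def T_def)
  finally show ?thesis by (simp add: T_def)
qed

section \<open>Factorization and comparison of numerator and denominator\<close>

definition rr_A :: "complex \<Rightarrow> complex" where
  "rr_A q = rr_G (q ^ 56) * rr_H q - q ^ 11 * (rr_G q * rr_H (q ^ 56))"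

definition rr_B :: "complex \<Rightarrow> complex" where
  "rr_B q = rr_G (q ^ 7) * rr_G (q ^ 8) + q ^ 3 * (rr_H (q ^ 7) * rr_H (q ^ 8))"

text \<open>By \<open>rr_phi\<close> and \<open>rr_phi_5\<close> the phi products combine to
  \<open>(P + R)(P' + R') - (P - R)(P' - R')\<close>, so only \<open>P R'\<close> and
  \<open>R P'\<close> survive. With the two remaining terms of \<open>(5,4,12)\<close> they are the
  four terms of \<open>rr_A q * rr_A (q^4)\<close>.\<close>

lemma numerator_factorization:
  assumes q: "norm q < 1"
  shows "qf_theta 1 0 56 q - qf_theta 5 4 12 q = 2 * q * (euler_E (q ^ 2) * euler_E (q ^ 112)) * (rr_A q * rr_A (q ^ 4))"
proof -
  have p: "norm (q ^ 56) < 1" using q by (intro norm_power_lt_1) auto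
  have pw: "q ^ 12 = q * q ^ 11" "q ^ 45 = q * q ^ 44" "q ^ 56 = q * q ^ 11 * q ^ 44"
    by (simp_all flip: power_Suc power_add)
  have 1: "qf_theta 1 0 56 q = ramanujan_f q q * ramanujan_f (q ^ 56) (q ^ 56)"
    using qf_theta_diagonal[OF q, of 1 56] by simp
  have phi: "ramanujan_f (q ^ 56) (q ^ 56) = euler_E (q ^ 112) * (rr_G (q ^ 56) * rr_G (q ^ 224) + q ^ 56 * (rr_H (q ^ 56) * rr_H (q ^ 224)))"
    "ramanujan_f (q ^ 280) (q ^ 280) = euler_E (q ^ 112) * (rr_G (q ^ 56) * rr_G (q ^ 224) - q ^ 56 * (rr_H (q ^ 56) * rr_H (q ^ 224)))"
    using rr_phi[OF p] rr_phi_5[OF p] by (simp_all flip: power_mult)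
  have f: "ramanujan_f (q ^ 168) (q ^ 392) = euler_E (q ^ 112) * rr_H (q ^ 56) * rr_G (q ^ 224)"
     "ramanujan_f (q ^ 56) (q ^ 504) = euler_E (q ^ 112) * rr_G (q ^ 56) * rr_H (q ^ 224)"
    using ramanujan_f_3_7[OF p] ramanujan_f_1_9[OF p] by (simp_all flip: power_mult)
  have A4: "rr_A (q ^ 4) = rr_G (q ^ 224) * rr_H (q ^ 4) - q ^ 44 * (rr_G (q ^ 4) * rr_H (q ^ 224))"
    by (simp add: rr_A_def flip: power_mult)
  show ?thesis
    unfolding 1 qf_theta_5_4_12[OF q] rr_phi[OF q] rr_phi_5[OF q] ramanujan_f_3_7[OF q] ramanujan_f_1_9[OF q]
      phi f A4 rr_A_def
    unfolding pw(1,2) 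
    by (subst (1 2) mult.commute[of "q ^ 56" "rr_H _ * rr_H _"]) (simp add: pw(3) algebra_simps)
qed

text \<open>Now the phi products are added, so \<open>P P'\<close> and \<open>R R'\<close> survive
  and form, with the two remaining terms of \<open>(3,2,19)\<close>, the expansion of
  \<open>rr_B q * rr_B (q^4)\<close>.\<close>

lemma denominator_factorization:
  assumes q: "norm q < 1"
  shows "qf_theta 7 0 8 q + qf_theta 3 2 19 q = 2 * (euler_E (q ^ 14) * euler_E (q ^ 16)) * (rr_B q * rr_B (q ^ 4))"
proof -
  have p7: "norm (q ^ 7) < 1" and p8: "norm (q ^ 8) < 1" using q by (auto intro!: norm_power_lt_1)
  have pw: "q ^ 7 * q ^ 8 = q ^ 3 * q ^ 12"
    by (simp flip: power_add)
  have 1: "qf_theta 7 0 8 q = ramanujan_f (q ^ 7) (q ^ 7) * ramanujan_f (q ^ 8) (q ^ 8)"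
    using qf_theta_diagonal[OF q, of 7 8] by simp
  define g h k l g4 h4 k4 l4 where defs: "g = rr_G (q ^ 7)" "h = rr_H (q ^ 7)" "k = rr_G (q ^ 8)" "l = rr_H (q ^ 8)"
    "g4 = rr_G (q ^ 28)" "h4 = rr_H (q ^ 28)" "k4 = rr_G (q ^ 32)" "l4 = rr_H (q ^ 32)"
  have phi: "ramanujan_f (q ^ 7) (q ^ 7) = euler_E (q ^ 14) * (g * g4 + q ^ 7 * (h * h4))"
    "ramanujan_f (q ^ 35) (q ^ 35) = euler_E (q ^ 14) * (g * g4 - q ^ 7 * (h * h4))"
    "ramanujan_f (q ^ 8) (q ^ 8) = euler_E (q ^ 16) * (k * k4 + q ^ 8 * (l * l4))"
    "ramanujan_f (q ^ 40) (q ^ 40) = euler_E (q ^ 16) * (k * k4 - q ^ 8 * (l * l4))"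
    using rr_phi[OF p7] rr_phi_5[OF p7] rr_phi[OF p8] rr_phi_5[OF p8] by (simp_all add: defs flip: power_mult)
  have f: "ramanujan_f (q ^ 21) (q ^ 49) = euler_E (q ^ 14) * h * g4"
     "ramanujan_f (q ^ 7) (q ^ 63) = euler_E (q ^ 14) * g * h4"
     "ramanujan_f (q ^ 24) (q ^ 56) = euler_E (q ^ 16) * l * k4"
     "ramanujan_f (q ^ 8) (q ^ 72) = euler_E (q ^ 16) * k * l4"
    using ramanujan_f_3_7[OF p7] ramanujan_f_1_9[OF p7] ramanujan_f_3_7[OF p8] ramanujan_f_1_9[OF p8]
    by (simp_all add: defs flip: power_mult)
  have B: "rr_B q = g * k + q ^ 3 * (h * l)" "rr_B (q ^ 4) = g4 * k4 + q ^ 12 * (h4 * l4)"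
    by (simp_all add: rr_B_def defs flip: power_mult)
  have "qf_theta 7 0 8 q + qf_theta 3 2 19 q = 2 * (euler_E (q ^ 14) * euler_E (q ^ 16)) *
      (g * g4 * k * k4 + (q ^ 7 * q ^ 8) * (h * h4 * l * l4) + q ^ 3 * (h * g4 * l * k4) + q ^ 12 * (g * h4 * k * l4))"
    unfolding 1 qf_theta_3_2_19[OF q] phi f by (simp add: algebra_simps)
  also have "\<dots> = 2 * (euler_E (q ^ 14) * euler_E (q ^ 16)) * (rr_B q * rr_B (q ^ 4))"
    unfolding pw B by (simp add: algebra_simps)
  finally show ?thesis .
qed

lemma rr_A_rr_B:
  assumes x: "norm x < 1"
  shows "rr_A x * (euler_E (x ^ 2) * euler_E (x ^ 28)) = rr_B x * (euler_E (x ^ 4) * euler_E (x ^ 14))"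
proof -
  have x4: "norm (x ^ 4) < 1" and x4m: "norm (- (x ^ 4)) < 1" and x7: "norm (x ^ 7) < 1" and x8: "norm (x ^ 8) < 1"
     and x28: "norm (x ^ 28) < 1" and x28m: "norm (- (x ^ 28)) < 1"
    using x by (auto simp: norm_power_lt_1)
  \<comment> \<open>\<open>a\<close> and \<open>b'\<close> have the shape of
    \<open>rogers_identity_1\<close> at \<open>-x^4\<close> and \<open>x^8\<close>;
    \<open>a'\<close> and \<open>b\<close> have that of \<open>rogers_identity_2\<close> at the same
    two points.\<close>
  define a b a' b' where
      "a = rr_G (- (x ^ 4)) * rr_G (x ^ 56) - x ^ 12 * (rr_H (- (x ^ 4)) * rr_H (x ^ 56))"
    and "b = rr_G (x ^ 56) * rr_H (x ^ 16) - x ^ 8 * (rr_G (x ^ 16) * rr_H (x ^ 56))"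
    and "a' = rr_G (- (x ^ 28)) * rr_H (x ^ 8) + x ^ 4 * (rr_G (x ^ 8) * rr_H (- (x ^ 28)))"
    and "b' = rr_G (x ^ 8) * rr_G (x ^ 112) + x ^ 24 * (rr_H (x ^ 8) * rr_H (x ^ 112))"
  define e where "e = (\<lambda>n. euler_E (x ^ n))"
  define m4 m28 where "m4 = euler_E (- (x ^ 4))" and "m28 = euler_E (- (x ^ 28))"
  have nz: "e n \<noteq> 0" if "n > 0" for n
    unfolding e_def using x that by (intro euler_E_nonzero norm_power_lt_1)
  have mnz: "m4 \<noteq> 0" "m28 \<noteq> 0"
    unfolding m4_def m28_def by (intro euler_E_nonzero x4m x28m)+
  have ra: "m4 * e 56 * a = e 8 * m28"
    using rogers_identity_1[OF x4m] by (simp add: a_def e_def m4_def m28_def flip: power_mult)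
  have rb: "e 16 * e 56 * b = e 8 * e 112"
    using rogers_identity_2[OF x8] by (simp add: b_def e_def flip: power_mult)
  have ra': "e 8 * m28 * a' = m4 * e 56"
    using rogers_identity_2[OF x4m] by (simp add: a'_def e_def m4_def m28_def flip: power_mult)
  have rb': "e 8 * e 112 * b' = e 16 * e 56"
    using rogers_identity_1[OF x8] by (simp add: b'_def e_def flip: power_mult)
  have m4: "m4 * (e 4 * e 16) = e 8 ^ 3"
    using euler_E_minus[OF x4] by (simp add: e_def m4_def flip: power_mult)
  have m28: "m28 * (e 28 * e 112) = e 56 ^ 3"
    using euler_E_minus[OF x28] by (simp add: e_def m28_def flip: power_mult)
  have A: "e 2 * rr_A x = e 8 * (a + x ^ 3 * b)"
  proof -
    have pw: "x ^ 12 = x ^ 11 * x" "x ^ 11 = x ^ 3 * x ^ 8"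
      by (simp_all flip: power_Suc2 power_add)
    have "e 2 * rr_A x = rr_G (x ^ 56) * (e 2 * rr_H x) - x ^ 11 * rr_H (x ^ 56) * (e 2 * rr_G x)"
      by (simp add: rr_A_def algebra_simps)
    also have "\<dots> = rr_G (x ^ 56) * (e 8 * (rr_G (- (x ^ 4)) + x ^ 3 * rr_H (x ^ 16)))
                   - x ^ 11 * rr_H (x ^ 56) * (e 8 * (rr_G (x ^ 16) + x * rr_H (- (x ^ 4))))"
      unfolding e_def rr_G_dissection[OF x] rr_H_dissection[OF x] ..
    also have "\<dots> = e 8 * (a + x ^ 3 * b)"
      unfolding a_def b_def pw by (simp add: algebra_simps)
    finally show ?thesis .
  qed
  have B: "e 14 * rr_B x = e 56 * (b' + x ^ 3 * a')"
  proof -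
    have dis: "e 14 * rr_G (x ^ 7) = e 56 * (rr_G (x ^ 112) + x ^ 7 * rr_H (- (x ^ 28)))"
      "e 14 * rr_H (x ^ 7) = e 56 * (rr_G (- (x ^ 28)) + x ^ 21 * rr_H (x ^ 112))"
      using rr_G_dissection[OF x7] rr_H_dissection[OF x7] by (simp_all add: e_def flip: power_mult)
    have pw: "x ^ 7 = x ^ 3 * x ^ 4" "x ^ 24 = x ^ 3 * x ^ 21"
      by (simp_all flip: power_add)
    have "e 14 * rr_B x = (e 14 * rr_G (x ^ 7)) * rr_G (x ^ 8) + x ^ 3 * (e 14 * rr_H (x ^ 7)) * rr_H (x ^ 8)"
      by (simp add: rr_B_def algebra_simps)
    also have "\<dots> = e 56 * (b' + x ^ 3 * a')"
      unfolding dis a'_def b'_def unfolding pw by (simp add: algebra_simps)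
    finally show ?thesis .
  qed
  have a: "a = e 8 * m28 / (m4 * e 56)" and a': "a' = m4 * e 56 / (e 8 * m28)"
    and b: "b = e 8 * e 112 / (e 16 * e 56)" and b': "b' = e 16 * e 56 / (e 8 * e 112)"
    using ra ra' rb rb' mnz nz[of 8] nz[of 56] nz[of 16] nz[of 112] by (simp_all add: field_simps)
  \<comment> \<open>\<open>euler_E_minus\<close> removes the Euler functions at \<open>-x^4\<close>
    and \<open>-x^28\<close>; what remains of \<open>a b\<close> is a quotient of four Euler
    functions.\<close>
  have prod: "a * b * (e 28 * e 8) = e 56 * e 4"
  proof -
    have m: "m4 = e 8 ^ 3 / (e 4 * e 16)" "m28 = e 56 ^ 3 / (e 28 * e 112)"
      using m4 m28 nz by (simp_all add: field_simps)
    show ?thesis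
      unfolding a b m using nz[of 8] nz[of 56] nz[of 16] nz[of 112] nz[of 28] nz[of 4]
      by (simp add: field_simps power3_eq_cube)
  qed
  have ab: "a + x ^ 3 * b = a * b * (b' + x ^ 3 * a')"
  proof -
    have "a * a' = 1" "b * b' = 1"
      unfolding a a' b b' using nz mnz by simp_all
    moreover have "a * b * (b' + x ^ 3 * a') = a * (b * b') + x ^ 3 * (b * (a * a'))"
      by (simp add: algebra_simps)
    ultimately show ?thesis by simp
  qed
  have "e 56 * (rr_A x * (e 2 * e 28)) = (e 2 * rr_A x) * (e 28 * e 56)"
    by (simp add: mult_ac)
  also have "\<dots> = (a * b * (e 28 * e 8)) * (e 56 * (b' + x ^ 3 * a'))"
    unfolding A ab by (simp add: mult_ac)
  also have "\<dots> = e 56 * (rr_B x * (e 4 * e 14))"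
    unfolding prod B[symmetric] by (simp add: mult_ac)
  finally show ?thesis
    using nz[of 56] by (simp add: e_def)
qed

theorem theorem4p5:
  fixes q Q :: complex
  assumes "norm q < 1"
    and "Q = q ^ 7"
    and "qf_theta 7 0 8 q + qf_theta 3 2 19 q \<noteq> 0"
  shows "(qf_theta 1 0 56 q - qf_theta 5 4 12 q) / (qf_theta 7 0 8 q + qf_theta 3 2 19 q)
       = q * ((euler_E (q ^ 4) * euler_E (Q ^ 8)) / (euler_E (q ^ 8) * euler_E (Q ^ 4)))"
proof -
  define e where "e = (\<lambda>n. euler_E (q ^ n))"
  have nz: "e n \<noteq> 0" if "n > 0" for n
    unfolding e_def using assms(1) that by (intro euler_E_nonzero norm_power_lt_1)
  let ?N = "qf_theta 1 0 56 q - qf_theta 5 4 12 q"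
  let ?D = "qf_theta 7 0 8 q + qf_theta 3 2 19 q"
  have 1: "rr_A q * (e 2 * e 28) = rr_B q * (e 4 * e 14)"
    using rr_A_rr_B[OF assms(1)] by (simp add: e_def)
  have 2: "rr_A (q ^ 4) * (e 8 * e 112) = rr_B (q ^ 4) * (e 16 * e 56)"
    using rr_A_rr_B[OF norm_power_lt_1[OF assms(1), of 4]] by (simp add: e_def flip: power_mult)
  \<comment> \<open>Multiplying by \<open>E(q^8) E(q^28)\<close> completes the Euler factors so that
    \<open>rr_A_rr_B\<close> applies at \<open>q\<close> and at \<open>q^4\<close>. Afterwards
    \<open>E(q^14) E(q^16)\<close> is absorbed by the denominator and \<open>E(q^4) E(q^56)\<close>
    remains.\<close>
  have "?N * (e 8 * e 28) = 2 * q * (rr_A q * (e 2 * e 28)) * (rr_A (q ^ 4) * (e 8 * e 112))"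
    unfolding numerator_factorization[OF assms(1)] by (simp add: e_def mult_ac)
  also have "\<dots> = q * (e 4 * e 56) * ?D"
    unfolding 1 2 denominator_factorization[OF assms(1)] by (simp add: e_def mult_ac)
  finally have "?N / ?D = q * ((e 4 * e 56) / (e 8 * e 28))"
    using assms(3) nz[of 8] nz[of 28] by (simp add: divide_eq_eq eq_divide_eq mult_ac)
  thus ?thesis
    by (simp add: assms(2) e_def flip: power_mult)
qed

end
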